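(* For every integer $\ell\ge 16$, \[\tilde{r}(P_3,P_3,C_\ell)=\begin{cases}(3\ell+1)/2, & \text{if } \ell \equiv 3\pmod{4}; \\ \left\lfloor 3(\ell+1)/2 \right\rfloor, & \text{otherwise}. \end{cases}\]
   Context: $P_m$ denotes the path on $m$ vertices and $C_m$ the cycle on $m$ vertices. The three-color online Ramsey game for graphs $G_1,G_2,G_3$ is played by Builder and Painter on an infinite vertex set with initially no edges. In each round Builder draws an edge between two currently nonadjacent vertices, and Painter immediately colors it with one of the colors red, blue, green. Builder wins once the colored graph contains a red copy of $G_1$, a blue copy of $G_2$, or a green copy of $G_3$ (as a subgraph). The online Ramsey number $\tilde{r}(G_1,G_2,G_3)$ is the minimum number of rounds within which Builder can guarantee a win against every strategy of Painter. *)

theory Defs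
  imports Main "HOL-Library.Extended_Nat"
begin

text \<open>A graph is a pair of a vertex set and a set of edges, each edge being a two-element set.\<close>

type_synonym 'a graph = "'a set \<times> 'a set set"

definition path_graph :: "nat \<Rightarrow> nat graph" where
  "path_graph m = ({..<m}, {{i, Suc i} | i. Suc i < m})"

text \<open>This is the cycle only for \<open>m \<ge> 3\<close>.\<close>

definition cycle_graph :: "nat \<Rightarrow> nat graph" where
  "cycle_graph m = ({..<m}, {{i, Suc i mod m} | i. i < m})"

text \<open>Copies are subgraphs, not necessarily induced ones.\<close>

definition contains_copy :: "'v graph \<Rightarrow> 'a graph \<Rightarrow> bool" where
  "contains_copy H G \<longleftrightarrow>
    (\<exists>f. inj_on f (fst G) \<and> f ` fst G \<subseteq> fst H \<and> (\<forall>e \<in> snd G. f ` e \<in> snd H))"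

datatype color = Red | Blue | Green

text \<open>The edges drawn so far with their colors, in chronological order.\<close>

type_synonym 'v history = "('v set \<times> color) list"

definition color_graph :: "'v set \<Rightarrow> 'v history \<Rightarrow> color \<Rightarrow> 'v graph" where
  "color_graph V h c = (V, {e. (e, c) \<in> set h})"

definition legal_move :: "'v set \<Rightarrow> 'v history \<Rightarrow> 'v set \<Rightarrow> bool" where
  "legal_move V h e \<longleftrightarrow> e \<subseteq> V \<and> card e = 2 \<and> e \<notin> fst ` set h"

text \<open>On an infinite board every history admits a legal move, so demanding legality on all
  histories, including those that the strategy never reaches, does not restrict Builder.\<close>

definition builder_strategy :: "'v set \<Rightarrow> ('v history \<Rightarrow> 'v set) \<Rightarrow> bool" where
  "builder_strategy V \<sigma> \<longleftrightarrow> (\<forall>h. legal_move V h (\<sigma> h))"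

text \<open>A Painter strategy \<open>\<pi>\<close> maps the history and the edge just drawn to a color.\<close>

primrec play :: "('v history \<Rightarrow> 'v set) \<Rightarrow> ('v history \<Rightarrow> 'v set \<Rightarrow> color) \<Rightarrow> nat \<Rightarrow> 'v history" where
  "play \<sigma> \<pi> 0 = []"
| "play \<sigma> \<pi> (Suc k) = (let h = play \<sigma> \<pi> k; e = \<sigma> h in h @ [(e, \<pi> h e)])"

definition builder_won :: "'v set \<Rightarrow> 'a graph \<Rightarrow> 'b graph \<Rightarrow> 'c graph \<Rightarrow> 'v history \<Rightarrow> bool" where
  "builder_won V G1 G2 G3 h \<longleftrightarrow>
    contains_copy (color_graph V h Red) G1 \<or>
    contains_copy (color_graph V h Blue) G2 \<or>
    contains_copy (color_graph V h Green) G3"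

definition builder_wins_within :: "'v set \<Rightarrow> 'a graph \<Rightarrow> 'b graph \<Rightarrow> 'c graph \<Rightarrow> nat \<Rightarrow> bool" where
  "builder_wins_within V G1 G2 G3 n \<longleftrightarrow>
    (\<exists>\<sigma>. builder_strategy V \<sigma> \<and> (\<forall>\<pi>. \<exists>k\<le>n. builder_won V G1 G2 G3 (play \<sigma> \<pi> k)))"

text \<open>The value is \<open>\<infinity>\<close> if Builder cannot guarantee a win within any fixed number of rounds.\<close>

definition online_ramsey :: "'v set \<Rightarrow> 'a graph \<Rightarrow> 'b graph \<Rightarrow> 'c graph \<Rightarrow> enat" where
  "online_ramsey V G1 G2 G3 = (INF n \<in> {n. builder_wins_within V G1 G2 G3 n}. enat n)"

end

theory Submission
  imports Defs
begin

text \<open>Lower bound: Painter uses red if possible, else blue if possible, else green. Every edge of a green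
  cycle then meets a red and a blue edge, so there are at least \<open>l / 4\<close> edges of either color. This
  leaves one round missing if 4 divides \<open>l\<close>; in that case Painter also refuses to close red-blue
  cycles.

  Upper bound: all further edges at a vertex that meets a red and a blue edge are forced to be green.
  Builder maintains one green path and at most two vertices off the path that meet a red or blue
  edge, and needs about three rounds for two further path edges, the exact surplus depending on what
  is known about the ends of the path. Finite decision trees turn every such position into one with a
  longer path or into a green cycle of the right length. They were found by a computer search that
  minimizes the surplus; their correctness is checked by simplification.\<close>

section \<open>Painter's strategies\<close>

text \<open>A red and a blue edge have four ends, enough for two vertices that meet both colors, and
  each of these serves two path edges. So four path edges cost six rounds, which is the common rate
  3/2 of both bounds; only the rounding depends on \<open>l mod 4\<close>. Counting gives Painter
  \<open>l + 2 * ((l + 3) div 4)\<close> rounds, which is the claimed value unless 4 divides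
  \<open>l\<close>. In that case the count can be tight only if the red and blue edges sit on the
  cycle without any waste, and the cautious Painter prevents exactly this. For Builder, every leaf
  of the opening except those of shape \<open>FFO\<close> leads to a total of
  \<open>(3 * l + 2) div 2\<close> rounds. An \<open>FFO\<close> position has two loose vertices of
  opposite colors. Each gain of two path edges switches between opposite and equal colors, and the
  cheapest closing needs opposite colors with three edges missing. Since \<open>l - 4\<close> edges
  are missing after the opening, this fits iff \<open>l mod 4 = 3\<close>. Otherwise one loose
  vertex is given up, for a total of \<open>(3 * l + 3) div 2\<close>.\<close>

lemma length_play [simp]: "length (play \<sigma> \<pi> k) = k"
  by (induction k) (auto simp: Let_def)

definition col :: "'v history \<Rightarrow> color \<Rightarrow> 'v set set" where
  "col h c = {e. (e, c) \<in> set h}"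

definition closed_under :: "'v history \<Rightarrow> 'v set \<Rightarrow> bool" where
  "closed_under h C \<longleftrightarrow> (\<forall>c\<in>{Red, Blue}. \<forall>e\<in>col h c. e \<subseteq> C \<or> e \<inter> C = {})"

definition separated :: "'v history \<Rightarrow> 'v set \<Rightarrow> bool" where
  "separated h e \<longleftrightarrow> (\<exists>C. closed_under h C \<and> e \<inter> C \<noteq> {} \<and> \<not> e \<subseteq> C)"

text \<open>The flag \<open>b\<close> selects the cautious variant, which never closes a red-blue cycle: the ends of
  \<open>e\<close> lie in different red-blue components iff \<open>separated h e\<close>.\<close>

definition painter :: "bool \<Rightarrow> 'v history \<Rightarrow> 'v set \<Rightarrow> color" where
  "painter b h e =
    (if b \<and> \<not> separated h e then Green
     else if e \<inter> \<Union> (col h Red) = {} then Red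
     else if e \<inter> \<Union> (col h Blue) = {} then Blue
     else Green)"

text \<open>All histories that legal moves can produce against this Painter. Invariants are proved
  on these by induction, independently of Builder's strategy.\<close>

inductive painted :: "'v set \<Rightarrow> bool \<Rightarrow> 'v history \<Rightarrow> bool" for V b where
  Nil: "painted V b []"
| snoc: "painted V b h \<Longrightarrow> legal_move V h e \<Longrightarrow> painted V b (h @ [(e, painter b h e)])"

lemma painted_play: "builder_strategy V \<sigma> \<Longrightarrow> painted V b (play \<sigma> (painter b) k)"
  by (induction k) (auto simp: Let_def builder_strategy_def intro: painted.intros)

section \<open>Invariants of Painter's histories\<close>

lemma col_Nil [simp]: "col [] c = {}"
  by (simp add: col_def)

lemma col_snoc: "col (h @ [(e, c)]) c' = (if c' = c then insert e (col h c') else col h c')"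
  by (auto simp: col_def)

lemma finite_col [simp]: "finite (col h c)"
proof -
  have "col h c \<subseteq> fst ` set h" by (force simp: col_def)
  then show ?thesis by (rule finite_subset) simp
qed

lemma col_mono: "set h \<subseteq> set h' \<Longrightarrow> col h c \<subseteq> col h' c"
  by (auto simp: col_def)

lemma new_not_col: "e \<notin> fst ` set h \<Longrightarrow> e \<notin> col h c"
  by (force simp: col_def)

lemma painted_edge:
  assumes "painted V b h" "e \<in> col h c"
  shows "e \<subseteq> V \<and> card e = 2"
  using assms by (induction) (auto simp: col_snoc legal_move_def split: if_splits)

lemma painted_length:
  assumes "painted V b h"
  shows "card (col h Red) + card (col h Blue) + card (col h Green) = length h"
  using assms
proof induction
  case (snoc h e)
  then have "e \<notin> fst ` set h" by (simp add: legal_move_def)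
  then have "e \<notin> col h c" for c by (rule new_not_col)
  with snoc.IH show ?case by (cases "painter b h e") (simp_all add: col_snoc)
qed simp

lemma painted_disjoint:
  assumes "painted V b h" "c \<noteq> Green" "e \<in> col h c" "e' \<in> col h c" "e \<noteq> e'"
  shows "e \<inter> e' = {}"
  using assms
proof (induction arbitrary: e e')
  case (snoc h x)
  have "x \<inter> \<Union> (col h c) = {}" if "painter b h x = c"
    using that \<open>c \<noteq> Green\<close> by (auto simp: painter_def split: if_splits)
  then show ?case using snoc by (auto simp: col_snoc split: if_splits)
qed simp

text \<open>Blue is used only where red is blocked. Hence, if no vertex meets both colors, there is
  no blue edge at all.\<close>

lemma painted_blue:
  assumes "painted V b h" "e \<in> col h Blue"
  shows "e \<inter> \<Union> (col h Red) \<noteq> {}"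
  using assms by induction (auto simp: col_snoc painter_def split: if_splits)

text \<open>In the second alternative \<open>h'\<close> is the history at which caution decided;
  \<open>e\<close> is still undrawn there, so it is not itself a red edge of
  \<open>h'\<close>.\<close>

lemma painted_green:
  assumes "painted V b h" "e \<in> col h Green"
  shows "e \<inter> \<Union> (col h Red) \<noteq> {} \<and> e \<inter> \<Union> (col h Blue) \<noteq> {} \<or>
    b \<and> (\<exists>h'. painted V b h' \<and> set h' \<subseteq> set h \<and> e \<notin> fst ` set h' \<and> \<not> separated h' e)"
  using assms
proof induction
  case (snoc h x)
  show ?case
  proof (cases "e \<in> col h Green")
    case True
    from snoc.IH[OF this] show ?thesis
    proof
      assume "b \<and> (\<exists>h'. painted V b h' \<and> set h' \<subseteq> set h \<and> e \<notin> fst ` set h' \<and> \<not> separated h' e)"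
      then show ?thesis by auto
    qed (auto simp: col_snoc)
  next
    case False
    with snoc.prems have e: "e = x" "painter b h x = Green" by (auto simp: col_snoc split: if_splits)
    then consider "b" "\<not> separated h x" | "x \<inter> \<Union> (col h Red) \<noteq> {}" "x \<inter> \<Union> (col h Blue) \<noteq> {}"
      by (auto simp: painter_def split: if_splits)
    then show ?thesis
    proof cases
      case 1
      then show ?thesis using snoc.hyps e by (auto simp: legal_move_def)
    next
      case 2
      then show ?thesis using e by (auto simp: col_snoc)
    qed
  qed
qed simp

text \<open>Only green edges follow the last non-green edge \<open>e\<close>, so the final red and
  blue edges are those right after \<open>e\<close>. The cut that separated the ends of
  \<open>e\<close> just before carries the parity argument.\<close>

lemma painted_last:
  assumes "painted V True h" "col h Red \<union> col h Blue \<noteq> {}"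
  shows "\<exists>h' e c. painted V True h' \<and> legal_move V h' e \<and> separated h' e \<and> c \<noteq> Green \<and>
    e \<inter> \<Union> (col h' c) = {} \<and> (\<forall>c'\<in>{Red, Blue}. col h c' = col (h' @ [(e, c)]) c')"
  using assms
proof induction
  case (snoc h x)
  show ?case
  proof (cases "painter True h x = Green")
    case True
    then have "col (h @ [(x, painter True h x)]) c' = col h c'" if "c' \<in> {Red, Blue}" for c'
      using that by (auto simp: col_snoc)
    with snoc show ?thesis by auto
  next
    case False
    then have "separated h x" "x \<inter> \<Union> (col h (painter True h x)) = {}"
      by (auto simp: painter_def split: if_splits)
    with snoc.hyps False show ?thesis by blast
  qed
qed simp

text \<open>Edges of one non-green color form a matching and do not cross the boundary of
  \<open>C\<close>, so they pair up the vertices that they cover in \<open>C\<close>. Mainly the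
  parity matters; \<open>C = UNIV\<close> gives the plain count.\<close>

lemma card_closed_inter:
  assumes "painted V b h" "c \<in> {Red, Blue}" "closed_under h C"
  shows "card (C \<inter> \<Union> (col h c)) = 2 * card {e \<in> col h c. e \<subseteq> C}"
proof -
  have eq: "C \<inter> \<Union> (col h c) = \<Union> {e \<in> col h c. e \<subseteq> C}"
    using assms(2,3) by (auto simp: closed_under_def)
  have "card (\<Union> {e \<in> col h c. e \<subseteq> C}) = sum card {e \<in> col h c. e \<subseteq> C}"
  proof (rule card_Union_disjoint)
    show "pairwise disjnt {e \<in> col h c. e \<subseteq> C}"
      using painted_disjoint[OF assms(1)] assms(2) by (auto simp: pairwise_def disjnt_def)
    show "finite e" if "e \<in> {e \<in> col h c. e \<subseteq> C}" for e
      using that painted_edge[OF assms(1)] by (auto intro: card_ge_0_finite)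
  qed
  also have "\<dots> = sum (\<lambda>_. 2) {e \<in> col h c. e \<subseteq> C}"
    using painted_edge[OF assms(1)] by (intro sum.cong) auto
  finally show ?thesis using eq by simp
qed

lemma card_Union_col:
  assumes "painted V b h" "c \<in> {Red, Blue}"
  shows "card (\<Union> (col h c)) = 2 * card (col h c)"
  using card_closed_inter[OF assms, of UNIV] by (simp add: closed_under_def)

lemma finite_Union_col:
  assumes "painted V b h"
  shows "finite (\<Union> (col h c))"
proof (rule finite_Union)
  show "finite e" if "e \<in> col h c" for e
    using painted_edge[OF assms that] by (intro card_ge_0_finite) simp
qed simp

lemma no_path3:
  assumes "painted V b h" "c \<noteq> Green"
  shows "\<not> contains_copy (color_graph V h c) (path_graph 3)"
proof
  assume "contains_copy (color_graph V h c) (path_graph 3)"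
  then obtain f where f: "inj_on f {..<3::nat}" "\<forall>e\<in>{{i, Suc i} |i. Suc i < 3}. f ` e \<in> col h c"
    by (auto simp: contains_copy_def path_graph_def color_graph_def col_def)
  have "{0, Suc 0} \<in> {{i, Suc i} |i. Suc i < 3}" "{Suc 0, Suc (Suc 0)} \<in> {{i, Suc i} |i. Suc i < 3}"
    by auto
  with f(2) have "f ` {0, Suc 0} \<in> col h c" "f ` {Suc 0, Suc (Suc 0)} \<in> col h c" by blast+
  then have *: "{f 0, f 1} \<in> col h c" "{f 1, f 2} \<in> col h c" by (simp_all add: numeral_2_eq_2)
  have "f 0 \<noteq> f 2" "f 0 \<noteq> f 1" 
    using inj_onD[OF f(1), of 0 2] inj_onD[OF f(1), of 0 1] by auto
  then have "{f 0, f 1} \<noteq> {f 1, f 2}" by (auto simp: doubleton_eq_iff)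
  from painted_disjoint[OF assms * this] show False by auto
qed

section \<open>Double counting along a green cycle\<close>

lemma bij_betw_Suc_mod: "bij_betw (\<lambda>i. Suc i mod l) {..<l} {..<l}"
proof (cases "l = 0")
  case False
  have "inj_on (\<lambda>i. Suc i mod l) {..<l}" by (auto simp: inj_on_def mod_Suc split: if_splits)
  moreover have "(\<lambda>i. Suc i mod l) ` {..<l} \<subseteq> {..<l}" using False by auto
  ultimately show ?thesis by (simp add: bij_betw_def endo_inj_surj)
qed (simp add: bij_betw_def)

lemma sum_consecutive:
  fixes g :: "nat \<Rightarrow> nat"
  shows "(\<Sum>i<l. g i + g (Suc i mod l)) = 2 * (\<Sum>i<l. g i)"
  using sum.reindex_bij_betw[OF bij_betw_Suc_mod, of g l] by (simp add: sum.distrib)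

lemma green_cycle_edges:
  assumes "painted V b h" "inj_on f {..<l}" "3 \<le> l" "\<And>i. i < l \<Longrightarrow> {f i, f (Suc i mod l)} \<in> col h Green"
  shows "l \<le> card (col h Green)"
proof -
  have "inj_on (\<lambda>i. {f i, f (Suc i mod l)}) {..<l}"
  proof (rule inj_onI)
    fix i j assume ij: "i \<in> {..<l}" "j \<in> {..<l}" "{f i, f (Suc i mod l)} = {f j, f (Suc j mod l)}"
    then have "i = j \<or> i = Suc j mod l \<and> Suc i mod l = j"
      using assms(2,3) by (auto simp: doubleton_eq_iff inj_on_eq_iff)
    then show "i = j" using ij(1,2) assms(3) by (auto simp: mod_Suc split: if_splits)
  qed
  then have "card ((\<lambda>i. {f i, f (Suc i mod l)}) ` {..<l}) = l" by (simp add: card_image)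
  moreover have "(\<lambda>i. {f i, f (Suc i mod l)}) ` {..<l} \<subseteq> col h Green" using assms(4) by auto
  ultimately show ?thesis by (metis card_mono finite_col)
qed

text \<open>A color covers two vertices per edge. If the cycle contains that many covered vertices,
  no edge of the color has an end elsewhere.\<close>

lemma card_touched_le:
  fixes l :: nat
  assumes "painted V b h" "c \<in> {Red, Blue}" "inj_on f {..<l}"
  shows "(\<Sum>i<l. of_bool (f i \<in> \<Union> (col h c))) \<le> 2 * card (col h c)"
    and "(\<Sum>i<l. of_bool (f i \<in> \<Union> (col h c))) = 2 * card (col h c) \<Longrightarrow> \<Union> (col h c) \<subseteq> f ` {..<l}"
proof -
  let ?X = "{i \<in> {..<l}. f i \<in> \<Union> (col h c)}"
  have X: "(\<Sum>i<l. of_bool (f i \<in> \<Union> (col h c))) = card (f ` ?X)"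
  proof -
    have "inj_on f ?X" by (rule inj_on_subset[OF assms(3)]) auto
    moreover have "card ?X = (\<Sum>i<l. of_bool (f i \<in> \<Union> (col h c)))"
      unfolding card_eq_sum of_bool_def by (rule sum.inter_filter) simp
    ultimately show ?thesis by (simp only: card_image)
  qed
  have sub: "f ` ?X \<subseteq> \<Union> (col h c)" by blast
  show "(\<Sum>i<l. of_bool (f i \<in> \<Union> (col h c))) \<le> 2 * card (col h c)"
    using card_mono[OF finite_Union_col[OF assms(1)] sub] X card_Union_col[OF assms(1,2)] by simp
  show "\<Union> (col h c) \<subseteq> f ` {..<l}"
    if "(\<Sum>i<l. of_bool (f i \<in> \<Union> (col h c))) = 2 * card (col h c)"
    using card_subset_eq[OF finite_Union_col[OF assms(1)] sub] that X card_Union_col[OF assms(1,2)] by auto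
qed

text \<open>An edge of one color has two ends, each on at most two cycle edges, so it blocks its
  color on at most four cycle edges. Each cycle edge must be blocked in both colors, and
  \<open>(l + 3) div 4\<close> is \<open>l / 4\<close> rounded up.\<close>

lemma greedy_cycle_length:
  assumes "painted V False h" "inj_on f {..<l}" "3 \<le> l"
    and edges: "\<And>i. i < l \<Longrightarrow> {f i, f (Suc i mod l)} \<in> col h Green"
  shows "l + 2 * ((l + 3) div 4) \<le> length h"
proof -
  have "(l + 3) div 4 \<le> card (col h c)" if c: "c \<in> {Red, Blue}" for c
  proof -
    let ?g = "\<lambda>i. of_bool (f i \<in> \<Union> (col h c)) :: nat"
    have "1 \<le> ?g i + ?g (Suc i mod l)" if "i < l" for i
      using painted_green[OF assms(1) edges[OF that]] c by auto
    then have "(\<Sum>i<l. 1) \<le> (\<Sum>i<l. ?g i + ?g (Suc i mod l))" by (intro sum_mono) auto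
    then have "l \<le> 4 * card (col h c)"
      using sum_consecutive[of ?g l] card_touched_le(1)[OF assms(1) c assms(2)] by simp
    then show ?thesis using div_le_mono[of "l + 3" "4 * card (col h c) + 3" 4] by simp
  qed
  from this[of Red] this[of Blue] show ?thesis
    using green_cycle_edges[OF assms] painted_length[OF assms(1)] by simp
qed

text \<open>Let \<open>D\<close> be the red-blue degree on the green cycle. Every cycle edge has degree sum at least 2, so
  with at most \<open>6 * m\<close> edges all these sums equal 2 and no red or blue edge leaves the cycle. If some
  degree is 1, then all are, so no edge is blue and the red edge at an end of a cycle edge separates
  its ends. Otherwise all degrees are 0 or 2, and the side of the cut that admitted the last
  non-green edge has an odd number of vertices on edges of one color.\<close>

lemma cautious_cycle_length:
  assumes p: "painted V True h" and inj: "inj_on f {..<l}" and l: "l = 4 * m" "0 < m"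
    and edges: "\<And>i. i < l \<Longrightarrow> {f i, f (Suc i mod l)} \<in> col h Green"
  shows "6 * m < length h"
proof (rule ccontr)
  assume "\<not> 6 * m < length h"
  moreover have "l \<le> card (col h Green)" using green_cycle_edges[OF p inj _ edges] l by simp
  ultimately have few: "card (col h Red) + card (col h Blue) \<le> 2 * m"
    using painted_length[OF p] l by simp
  let ?g = "\<lambda>c i. of_bool (f i \<in> \<Union> (col h c)) :: nat"
  let ?D = "\<lambda>i. ?g Red i + ?g Blue i"
  have two: "2 \<le> ?D i + ?D (Suc i mod l)" if "i < l" for i
  proof -
    let ?u = "f i" and ?v = "f (Suc i mod l)"
    from painted_green[OF p edges[OF that]]
    consider "{?u, ?v} \<inter> \<Union> (col h Red) \<noteq> {}" "{?u, ?v} \<inter> \<Union> (col h Blue) \<noteq> {}"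
      | h' where "painted V True h'" "set h' \<subseteq> set h" "\<not> separated h' {?u, ?v}" by blast
    then show ?thesis
    proof cases
      case 1
      then show ?thesis by auto
    next
      case 2
      have neq: "?u \<noteq> ?v" using painted_edge[OF p edges[OF that]] by auto
      have "x \<in> \<Union> (col h Red) \<union> \<Union> (col h Blue)" if x: "x \<in> {?u, ?v}" for x
      proof (rule ccontr)
        assume "x \<notin> \<Union> (col h Red) \<union> \<Union> (col h Blue)"
        \<comment> \<open>An untouched vertex is a red-blue component of its own and would separate
          the ends.\<close>
        then have "closed_under h' {x}"
          using col_mono[OF 2(2)] by (fastforce simp: closed_under_def)
        moreover have "{?u, ?v} \<inter> {x} \<noteq> {} \<and> \<not> {?u, ?v} \<subseteq> {x}" using x neq by auto
        ultimately show False using 2(3) by (auto simp: separated_def)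
      qed
      from this[of ?u] this[of ?v] show ?thesis by auto
    qed
  qed
  have sumD: "(\<Sum>i<l. ?D i) = (\<Sum>i<l. ?g Red i) + (\<Sum>i<l. ?g Blue i)" by (simp add: sum.distrib)
  have "(\<Sum>i<l. 2) \<le> (\<Sum>i<l. ?D i + ?D (Suc i mod l))" using two by (intro sum_mono) auto
  then have lower: "l \<le> (\<Sum>i<l. ?D i)" using sum_consecutive[of ?D l] by simp
  have le: "(\<Sum>i<l. ?g c i) \<le> 2 * card (col h c)" if "c \<in> {Red, Blue}" for c
    using card_touched_le(1)[OF p that inj] .
  have eqs: "(\<Sum>i<l. ?g Red i) = 2 * card (col h Red)" "(\<Sum>i<l. ?g Blue i) = 2 * card (col h Blue)"
    "(\<Sum>i<l. ?D i) = l"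
    using lower le[of Red] le[of Blue] few sumD l by auto
  have on: "\<Union> (col h c) \<subseteq> f ` {..<l}" if "c \<in> {Red, Blue}" for c
    using card_touched_le(2)[OF p that inj] eqs that by auto
  have exact: "?D i + ?D (Suc i mod l) = 2" if i: "i < l" for i
  proof (rule ccontr)
    assume "?D i + ?D (Suc i mod l) \<noteq> 2"
    then have "2 < ?D i + ?D (Suc i mod l)" using two[OF i] by linarith
    then have ex: "\<exists>i\<in>{..<l}. 2 < ?D i + ?D (Suc i mod l)" using i by blast
    have "(\<Sum>i<l. 2) < (\<Sum>i<l. ?D i + ?D (Suc i mod l))"
      by (rule sum_strict_mono_ex1[OF _ _ ex]) (use two in blast)+
    then show False using sum_consecutive[of ?D l] eqs(3) by simp
  qed
  show False
  proof (cases "\<exists>i<l. ?D i = 1")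
    case True
    then obtain i where i: "i < l" "?D i = 1" by blast
    have all: "?D ((i + k) mod l) = 1" for k
    proof (induction k)
      case 0
      then show ?case using i by simp
    next
      case (Suc k)
      have "(i + k) mod l < l" using l by simp
      from exact[OF this] Suc show ?case by (simp add: mod_Suc_eq)
    qed
    have one: "?D j = 1" if "j < l" for j
    proof -
      have "(i + (j + l - i)) mod l = j" using i(1) that by simp
      then show ?thesis using all[of "j + l - i"] by (simp only:)
    qed
    have "\<Union> (col h Red) \<inter> \<Union> (col h Blue) = {}"
    proof (rule ccontr)
      assume "\<Union> (col h Red) \<inter> \<Union> (col h Blue) \<noteq> {}"
      then obtain x where "x \<in> \<Union> (col h Red)" "x \<in> \<Union> (col h Blue)" by blast
      moreover from this obtain j where "j < l" "x = f j" using on[of Red] by auto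
      ultimately show False using one[of j] by simp
    qed
    then have noblue: "col h Blue = {}" using painted_blue[OF p] by fast
    have "0 < l" using l by simp
    let ?e = "{f 0, f (Suc 0 mod l)}"
    obtain h' where h': "painted V True h'" "set h' \<subseteq> set h" "?e \<notin> fst ` set h'" "\<not> separated h' ?e"
      using painted_green[OF p edges[OF \<open>0 < l\<close>]] noblue by auto
    have neq: "f 0 \<noteq> f (Suc 0 mod l)" using painted_edge[OF p edges[OF \<open>0 < l\<close>]] by auto
    have noblue': "col h' Blue = {}" using noblue col_mono[OF h'(2), of Blue] by simp
    have "separated h' ?e"
    proof (cases "\<exists>e'\<in>col h' Red. f 0 \<in> e'")
      case True
      then obtain e' where e': "e' \<in> col h' Red" "f 0 \<in> e'" by blast
      have "closed_under h' e'"
        using painted_disjoint[OF h'(1) _ _ e'(1)] noblue' by (auto simp: closed_under_def)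
      moreover have "\<not> ?e \<subseteq> e'"
      proof
        assume "?e \<subseteq> e'"
        moreover have "card e' = 2" using painted_edge[OF h'(1) e'(1)] by simp
        ultimately have "?e = e'" using neq by (intro card_subset_eq) (auto intro: card_ge_0_finite)
        with e'(1) h'(3) show False using new_not_col by blast
      qed
      ultimately show ?thesis using e'(2) unfolding separated_def by blast
    next
      case False
      then have "closed_under h' {f 0}" using noblue' by (auto simp: closed_under_def)
      then show ?thesis using neq unfolding separated_def by (intro exI[of _ "{f 0}"]) auto
    qed
    with h'(4) show False by contradiction
  next
    case False
    have both: "\<Union> (col h Red) = \<Union> (col h Blue)"
    proof -
      have "f i \<in> \<Union> (col h Red) \<longleftrightarrow> f i \<in> \<Union> (col h Blue)" if "i < l" for i
        using False that by (auto simp: of_bool_def split: if_splits)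
      then show ?thesis using on[of Red] on[of Blue] by blast
    qed
    have "col h Red \<union> col h Blue \<noteq> {}"
    proof
      assume "col h Red \<union> col h Blue = {}"
      then show False using exact[of 0] l by simp
    qed
    from painted_last[OF p this] obtain h' e c where h': "painted V True h'" "legal_move V h' e"
      "separated h' e" "c \<noteq> Green" "e \<inter> \<Union> (col h' c) = {}"
      "\<forall>c'\<in>{Red, Blue}. col h c' = col (h' @ [(e, c)]) c'" by blast
    then obtain C where C: "closed_under h' C" "e \<inter> C \<noteq> {}" "\<not> e \<subseteq> C" by (auto simp: separated_def)
    define d where "d = (if c = Red then Blue else Red)"
    have cd: "c \<in> {Red, Blue}" "d \<in> {Red, Blue}" "c \<noteq> d" using h'(4) by (cases c; simp add: d_def)+
    have cols: "col h c = insert e (col h' c)" "col h d = col h' d" using h'(6) cd by (auto simp: col_snoc)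
    have "\<Union> (col h c) = \<Union> (col h d)" using both cd by auto
    \<comment> \<open>In the end both colors cover the same vertices, and \<open>e\<close> adds only
      to \<open>c\<close>. So before \<open>e\<close> was drawn, \<open>d\<close> covered exactly
      one vertex of \<open>C\<close> more than \<open>c\<close>, although both numbers are
      even.\<close>
    then have "C \<inter> \<Union> (col h' d) = (C \<inter> e) \<union> (C \<inter> \<Union> (col h' c))" using cols by auto
    moreover have "(C \<inter> e) \<inter> (C \<inter> \<Union> (col h' c)) = {}" using h'(5) by auto
    moreover have "finite e" "card e = 2" using h'(2) by (auto simp: legal_move_def intro: card_ge_0_finite)
    ultimately have "card (C \<inter> \<Union> (col h' d)) = card (C \<inter> e) + card (C \<inter> \<Union> (col h' c))"
      using finite_Union_col[OF h'(1), of c] by (simp add: card_Un_disjoint)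
    moreover have "card (C \<inter> e) = 1"
    proof -
      have "C \<inter> e \<subset> e" using C(3) by auto
      then have "card (C \<inter> e) < 2" using psubset_card_mono[OF \<open>finite e\<close>] \<open>card e = 2\<close> by metis
      moreover have "card (C \<inter> e) \<noteq> 0" using C(2) \<open>finite e\<close> by auto
      ultimately show ?thesis by simp
    qed
    ultimately show False
      using card_closed_inter[OF h'(1) cd(1) C(1)] card_closed_inter[OF h'(1) cd(2) C(1)] by presburger
  qed
qed

lemma cycle_copy_edges:
  assumes "contains_copy (color_graph V h Green) (cycle_graph l)"
  obtains f where "inj_on f {..<l}" "\<And>i. i < l \<Longrightarrow> {f i, f (Suc i mod l)} \<in> col h Green"
proof -
  from assms obtain f where f: "inj_on f {..<l}"
    "\<forall>e\<in>{{i, Suc i mod l} |i. i < l}. f ` e \<in> col h Green"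
    by (auto simp: contains_copy_def cycle_graph_def color_graph_def col_def)
  have "{f i, f (Suc i mod l)} \<in> col h Green" if "i < l" for i
    using f(2)[rule_format, of "{i, Suc i mod l}"] that by auto
  with f(1) show thesis by (rule that)
qed

lemma wins_within_lower_bound:
  assumes "builder_wins_within V (path_graph 3) (path_graph 3) (cycle_graph l) n" "3 \<le> l"
  shows "(if l mod 4 = 3 then (3 * l + 1) div 2 else (3 * (l + 1)) div 2) \<le> n"
proof -
  obtain \<sigma> where \<sigma>: "builder_strategy V \<sigma>"
    "\<And>\<pi>. \<exists>k\<le>n. builder_won V (path_graph 3) (path_graph 3) (cycle_graph l) (play \<sigma> \<pi> k)"
    using assms(1) by (auto simp: builder_wins_within_def)
  define b where "b \<longleftrightarrow> l mod 4 = 0"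
  obtain k where k: "k \<le> n" "builder_won V (path_graph 3) (path_graph 3) (cycle_graph l) (play \<sigma> (painter b) k)"
    using \<sigma>(2) by blast
  define h where "h = play \<sigma> (painter b) k"
  have p: "painted V b h" unfolding h_def by (rule painted_play[OF \<sigma>(1)])
  have len: "length h = k" by (simp add: h_def)
  have "contains_copy (color_graph V h Green) (cycle_graph l)"
    using k(2) no_path3[OF p] by (auto simp: builder_won_def h_def)
  then obtain f where f: "inj_on f {..<l}" "\<And>i. i < l \<Longrightarrow> {f i, f (Suc i mod l)} \<in> col h Green"
    by (rule cycle_copy_edges) blast
  show ?thesis
  proof (cases b)
    case True
    then obtain m where m: "l = 4 * m" "0 < m" using assms(2) by (auto simp: b_def)
    have "6 * m < length h" using cautious_cycle_length[of V h f l m, OF _ f(1) m f(2)] p True by simp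
    then show ?thesis using m len k(1) by auto
  next
    case False
    then have le: "l + 2 * ((l + 3) div 4) \<le> n"
      using greedy_cycle_length[of V h f l, OF _ f(1) assms(2) f(2)] p len k(1) by simp
    have "\<exists>q. l = 4 * q + 1 \<or> l = 4 * q + 2 \<or> l = 4 * q + 3"
      using False unfolding b_def by presburger
    then obtain q where "l = 4 * q + 1 \<or> l = 4 * q + 2 \<or> l = 4 * q + 3" by blast
    then show ?thesis
    proof (elim disjE)
      assume q: "l = 4 * q + 1"
      have "(4 * q + 1 + 3) div 4 = q + 1" "(3 * (4 * q + 1 + 1)) div 2 = 6 * q + 3" by simp_all
      then show ?thesis using le unfolding q by simp
    next
      assume q: "l = 4 * q + 2"
      have "(4 * q + 2 + 3) div 4 = q + 1" "(3 * (4 * q + 2 + 1)) div 2 = 6 * q + 4" by simp_all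
      then show ?thesis using le unfolding q by simp presburger
    next
      assume q: "l = 4 * q + 3"
      have "(4 * q + 3 + 3) div 4 = q + 1" "(3 * (4 * q + 3) + 1) div 2 = 6 * q + 5" by simp_all
      then show ?thesis using le unfolding q by simp
    qed
  qed
qed

section \<open>Forced wins of Builder\<close>

abbreviation won :: "'v set \<Rightarrow> nat \<Rightarrow> 'v history \<Rightarrow> bool" where
  "won V l \<equiv> builder_won V (path_graph 3) (path_graph 3) (cycle_graph l)"

text \<open>The game as alternating quantifiers, which a decision tree can follow move by
  move.\<close>

fun winning :: "'v set \<Rightarrow> nat \<Rightarrow> nat \<Rightarrow> 'v history \<Rightarrow> bool" where
  "winning V l 0 h \<longleftrightarrow> won V l h"
| "winning V l (Suc n) h \<longleftrightarrow>
    won V l h \<or> (\<exists>e. legal_move V h e \<and> (\<forall>c. winning V l n (h @ [(e, c)])))"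

lemma won_imp_winning: "won V l h \<Longrightarrow> winning V l n h"
  by (cases n) auto

lemma winning_mono: "winning V l n h \<Longrightarrow> n \<le> m \<Longrightarrow> winning V l m h"
proof (induction n arbitrary: h m)
  case 0
  then show ?case by (simp add: won_imp_winning)
next
  case (Suc n)
  then obtain m' where m: "m = Suc m'" "n \<le> m'"
    by (metis Suc_le_D Suc_le_mono)
  with Suc show ?case by auto
qed

lemma legal_move_exists:
  assumes "infinite V"
  shows "\<exists>e. legal_move V h e"
proof -
  obtain x where x: "x \<in> V" using assms infinite_imp_nonempty by blast
  have "infinite ((\<lambda>y. {x, y}) ` (V - {x}))"
    using assms by (subst finite_image_iff) (auto simp: inj_on_def doubleton_eq_iff)
  then obtain e where "e \<in> (\<lambda>y. {x, y}) ` (V - {x})" "e \<notin> fst ` set h"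
    by (metis List.finite_set finite_imageI finite_subset subsetI)
  with x show ?thesis by (auto simp: legal_move_def intro!: exI[of _ e])
qed

text \<open>The length of the history tells how many rounds are left, so a good move can be chosen
  from the history alone. Histories without a good move get an arbitrary legal one, which exists
  because \<open>V\<close> is infinite.\<close>

lemma winning_imp_wins_within:
  assumes "infinite V" and "winning V l n []"
  shows "builder_wins_within V (path_graph 3) (path_graph 3) (cycle_graph l) n"
proof -
  define good where
    "good h e \<longleftrightarrow> legal_move V h e \<and> (\<forall>c. winning V l (n - Suc (length h)) (h @ [(e, c)]))" for h e
  define \<sigma> where "\<sigma> h = (if Ex (good h) then SOME e. good h e else SOME e. legal_move V h e)" for h
  have strat: "builder_strategy V \<sigma>"
    unfolding builder_strategy_def
  proof
    fix h
    show "legal_move V h (\<sigma> h)"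
    proof (cases "Ex (good h)")
      case True
      then have "good h (\<sigma> h)" using someI_ex[OF True] by (simp add: \<sigma>_def)
      then show ?thesis by (simp add: good_def)
    next
      case False
      then have "\<sigma> h = (SOME e. legal_move V h e)" unfolding \<sigma>_def by (simp only: if_False)
      then show ?thesis using someI_ex[OF legal_move_exists[OF assms(1), of h]] by simp
    qed
  qed
  have "\<exists>k\<le>n. won V l (play \<sigma> \<pi> k)" for \<pi>
  proof (rule ccontr)
    assume none: "\<not> (\<exists>k\<le>n. won V l (play \<sigma> \<pi> k))"
    have "k \<le> n \<Longrightarrow> winning V l (n - k) (play \<sigma> \<pi> k)" for k
    proof (induction k)
      case 0
      then show ?case using assms by simp
    next
      case (Suc k)
      let ?h = "play \<sigma> \<pi> k"
      have "winning V l (Suc (n - Suc k)) ?h"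
        using Suc by (simp add: Suc_diff_Suc)
      moreover have "\<not> won V l ?h" using none Suc by simp
      ultimately obtain e where "legal_move V ?h e" "\<forall>c. winning V l (n - Suc k) (?h @ [(e, c)])"
        by auto
      then have "good ?h e" by (simp add: good_def)
      then have ex: "Ex (good ?h)" by (rule exI)
      then have "\<sigma> ?h = Eps (good ?h)" unfolding \<sigma>_def by (simp only: if_True)
      then have "good ?h (\<sigma> ?h)" using someI_ex[OF ex] by simp
      then show ?case by (auto simp: good_def Let_def)
    qed
    from this[of n] none show False by auto
  qed
  with strat show ?thesis by (auto simp: builder_wins_within_def)
qed

section \<open>Local positions and forced edges\<close>

definition touches :: "'v set \<Rightarrow> 'v history \<Rightarrow> color \<Rightarrow> 'v \<Rightarrow> bool" where
  "touches V h c v \<longleftrightarrow> (\<exists>w\<in>V. w \<noteq> v \<and> ({v, w}, c) \<in> set h)"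

lemma touches_append: "touches V h c v \<Longrightarrow> touches V (h @ h') c v"
  by (auto simp: touches_def)

lemma contains_path3:
  assumes "u \<in> V" "v \<in> V" "w \<in> V" "u \<noteq> v" "w \<noteq> v" "u \<noteq> w"
    and "({u, v}, c) \<in> set h" "({v, w}, c) \<in> set h"
  shows "contains_copy (color_graph V h c) (path_graph 3)"
proof -
  let ?f = "\<lambda>i::nat. if i = 0 then u else if i = 1 then v else w"
  have "inj_on ?f {..<3}" using assms by (auto simp: inj_on_def)
  moreover have "?f ` {..<3} \<subseteq> V" using assms by auto
  moreover have "?f ` {i, Suc i} \<in> {e. (e, c) \<in> set h}" if "Suc i < 3" for i
  proof -
    have "i = 0 \<or> i = 1" using that by auto
    then show ?thesis using assms by (auto simp: insert_commute)
  qed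
  ultimately show ?thesis
    unfolding contains_copy_def color_graph_def path_graph_def
    by (intro exI[of _ ?f]) auto
qed

lemma touches_won:
  assumes "touches V h c v" "v \<in> V" "u \<in> V" "u \<noteq> v" "{u, v} \<notin> fst ` set h" "c = Red \<or> c = Blue"
  shows "won V l (h @ [({u, v}, c)])"
proof -
  obtain w where w: "w \<in> V" "w \<noteq> v" "({v, w}, c) \<in> set h"
    using assms(1) by (auto simp: touches_def)
  \<comment> \<open>\<open>{v, w}\<close> has been drawn and \<open>{u, v}\<close> has not.\<close>
  have "u \<noteq> w" using assms(5) w(3) by (force simp: insert_commute)
  then have "contains_copy (color_graph V (h @ [({u, v}, c)]) c) (path_graph 3)"
    using assms w by (intro contains_path3[of u V v w]) auto
  with assms(6) show ?thesis by (auto simp: builder_won_def)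
qed

lemma contains_cycle:
  assumes "distinct xs" "set xs \<subseteq> V" "length xs = l" "l \<noteq> 0"
    and "successively (\<lambda>x y. ({x, y}, c) \<in> set h) xs" "({last xs, hd xs}, c) \<in> set h"
  shows "contains_copy (color_graph V h c) (cycle_graph l)"
proof -
  have "(!) xs ` {i, Suc i mod l} \<in> {e. (e, c) \<in> set h}" if "i < l" for i
  proof (cases "Suc i < l")
    case True
    then show ?thesis using assms(3,5) by (auto simp: successively_conv_nth)
  next
    case False
    then have "Suc i = l" using that by simp
    moreover from this have "xs ! i = last xs" using assms(3) by (cases xs rule: rev_cases) (auto simp: nth_append)
    moreover have "xs ! 0 = hd xs" using assms(3,4) by (cases xs) auto
    ultimately show ?thesis using assms(6) by (auto simp: insert_commute)
  qed
  moreover have "inj_on ((!) xs) {..<l}" using assms by (auto simp: inj_on_def nth_eq_iff_index_eq)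
  moreover have "(!) xs ` {..<l} \<subseteq> V" using assms(2,3) by auto
  ultimately show ?thesis
    unfolding contains_copy_def color_graph_def cycle_graph_def
    by (intro exI[of _ "(!) xs"]) auto
qed

text \<open>A local position on the vertices named by natural numbers. \<open>Board R B G U\<close> records vertices known
  to meet an edge of the first and of the second non-green color, some green edges, and pairs that
  may have been drawn already. Every pair outside \<open>G\<close> and \<open>U\<close> has not been drawn yet, so all names
  that occur nowhere denote fresh vertices.\<close>

datatype board = Board "nat list" "nat list" "(nat \<times> nat) list" "(nat \<times> nat) list"

definition joined :: "(nat \<times> nat) list \<Rightarrow> nat \<times> nat \<Rightarrow> bool" where
  "joined es = (\<lambda>(u, v). (u, v) \<in> set es \<or> (v, u) \<in> set es)"

fun realizes :: "'v set \<Rightarrow> 'v history \<Rightarrow> (nat \<Rightarrow> 'v) \<Rightarrow> color \<Rightarrow> color \<Rightarrow> board \<Rightarrow> bool" where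
  "realizes V h f c d (Board R B G U) \<longleftrightarrow>
    inj f \<and> range f \<subseteq> V \<and> {c, d} = {Red, Blue} \<and>
    (\<forall>i\<in>set R. touches V h c (f i)) \<and> (\<forall>i\<in>set B. touches V h d (f i)) \<and>
    (\<forall>(i, j)\<in>set G. ({f i, f j}, Green) \<in> set h) \<and>
    (\<forall>i j. i \<noteq> j \<longrightarrow> \<not> joined (G @ U) (i, j) \<longrightarrow> {f i, f j} \<notin> fst ` set h)"

lemma realizes_legal:
  assumes "realizes V h f c d (Board R B G U)" "u \<noteq> v" "\<not> joined (G @ U) (u, v)"
  shows "legal_move V h {f u, f v}"
  using assms by (auto simp: legal_move_def card_insert_if inj_eq)

lemma realizes_green:
  assumes "realizes V h f c d (Board R B G U)"
  shows "realizes V (h @ [({f u, f v}, Green)]) f c d (Board R B ((u, v) # G) U)"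
  using assms by (auto simp: touches_append joined_def doubleton_eq_iff inj_eq)

lemma realizes_nongreen:
  assumes "realizes V h f c d (Board R B G U)" "u \<noteq> v"
  shows "realizes V (h @ [({f u, f v}, c)]) f c d (Board (u # v # R) B G ((u, v) # U))"
    and "realizes V (h @ [({f u, f v}, d)]) f c d (Board R (u # v # B) G ((u, v) # U))"
proof -
  have "f u \<in> V" "f v \<in> V" "f u \<noteq> f v" using assms by (auto simp: inj_eq)
  then have "touches V (h @ [({f u, f v}, x)]) x (f u)" "touches V (h @ [({f u, f v}, x)]) x (f v)" for x
    unfolding touches_def by (auto intro: bexI[of _ "f v"] bexI[of _ "f u"] simp: insert_commute)
  with assms show "realizes V (h @ [({f u, f v}, c)]) f c d (Board (u # v # R) B G ((u, v) # U))"
    and "realizes V (h @ [({f u, f v}, d)]) f c d (Board R (u # v # B) G ((u, v) # U))"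
    by (auto simp: touches_append joined_def doubleton_eq_iff inj_eq)
qed

lemma realizes_swap:
  "realizes V h f c d (Board R B G U) \<Longrightarrow> realizes V h f d c (Board B R G U)"
  by (auto simp: insert_commute)

lemma realizes_blocked:
  assumes "realizes V h f c d (Board R B G U)" "u \<noteq> v" "\<not> joined (G @ U) (u, v)"
  shows "u \<in> set R \<or> v \<in> set R \<Longrightarrow> won V l (h @ [({f u, f v}, c)])"
    and "u \<in> set B \<or> v \<in> set B \<Longrightarrow> won V l (h @ [({f u, f v}, d)])"
proof -
  have *: "f u \<in> V" "f v \<in> V" "f u \<noteq> f v" "{f u, f v} \<notin> fst ` set h" "{f v, f u} \<notin> fst ` set h"
    using assms by (auto simp: inj_eq insert_commute)
  have cd: "c = Red \<or> c = Blue" "d = Red \<or> d = Blue" using assms by (auto simp: doubleton_eq_iff)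
  show "won V l (h @ [({f u, f v}, c)])" if "u \<in> set R \<or> v \<in> set R"
    using that assms * cd touches_won[of V h c "f u" "f v"] touches_won[of V h c "f v" "f u"]
    by (auto simp: insert_commute)
  show "won V l (h @ [({f u, f v}, d)])" if "u \<in> set B \<or> v \<in> set B"
    using that assms * cd touches_won[of V h d "f u" "f v"] touches_won[of V h d "f v" "f u"]
    by (auto simp: insert_commute)
qed

lemma realizes_colors:
  assumes "realizes V h f c d b"
  shows "x = c \<or> x = d \<or> x = Green"
proof -
  have "{c, d} = {Red, Blue}" using assms by (cases b) auto
  then show ?thesis by (cases x) (auto simp: doubleton_eq_iff)
qed

text \<open>The edges that are not yet green must be forced: Painter loses at once if one of them is colored
  red or blue.\<close>

fun drawable :: "board \<Rightarrow> (nat \<times> nat) list \<Rightarrow> bool" where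
  "drawable (Board R B G U) es \<longleftrightarrow> (\<forall>(u, v)\<in>set es. u \<noteq> v \<and>
    (joined G (u, v) \<or> (u \<in> set R \<or> v \<in> set R) \<and> (u \<in> set B \<or> v \<in> set B) \<and> \<not> joined U (u, v)))"

fun missing :: "board \<Rightarrow> (nat \<times> nat) list \<Rightarrow> nat" where
  "missing (Board R B G U) es = length (filter (\<lambda>e. \<not> joined G e) es)"

lemma length_filter_mono: "(\<And>x. P x \<Longrightarrow> Q x) \<Longrightarrow> length (filter P xs) \<le> length (filter Q xs)"
  by (induction xs) auto

text \<open>A forced edge that is colored red or blue completes a \<open>path_graph 3\<close> at
  once. So the edges can be drawn in order, for one round per edge that is not green yet, and
  \<open>n\<close> rounds remain for the position reached.\<close>

lemma draw_forced:
  assumes "realizes V h f c d (Board R B G U)" "drawable (Board R B G U) es"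
    and "\<And>h' G'. realizes V h' f c d (Board R B G' U) \<Longrightarrow> set G' = set es \<union> set G \<Longrightarrow>
      set h \<subseteq> set h' \<Longrightarrow> winning V l n h'"
  shows "winning V l (missing (Board R B G U) es + n) h"
  using assms
proof (induction es arbitrary: h G)
  case Nil
  then show ?case using Nil.prems(3)[OF Nil.prems(1)] by simp
next
  case (Cons e es)
  obtain u v where e: "e = (u, v)" by fastforce
  have uv: "u \<noteq> v" using Cons.prems e by simp
  have draw: "drawable (Board R B (e # G) U) es"
    using Cons.prems(2) by (fastforce simp: joined_def)
  have miss: "missing (Board R B (e # G) U) es \<le> missing (Board R B G U) es"
    unfolding missing.simps
    by (rule length_filter_mono) (auto simp: joined_def)
  show ?case
  proof (cases "joined G e")
    case True
    then have "({f u, f v}, Green) \<in> set h"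
      using Cons.prems(1) by (auto simp: e joined_def insert_commute)
    then have "realizes V h f c d (Board R B (e # G) U)"
      using Cons.prems(1) True by (auto simp: e joined_def insert_commute)
    then have "winning V l (missing (Board R B (e # G) U) es + n) h"
      using draw by (rule Cons.IH) (erule Cons.prems(3), auto)
    then show ?thesis using True miss by (auto intro: winning_mono)
  next
    case False
    then have new: "\<not> joined (G @ U) (u, v)" and blocked: "u \<in> set R \<or> v \<in> set R" "u \<in> set B \<or> v \<in> set B"
      using Cons.prems(2) by (auto simp: e joined_def)
    let ?m = "missing (Board R B G U) es + n"
    have "winning V l ?m (h @ [({f u, f v}, x)])" for x
    proof -
      consider "x = c" | "x = d" | "x = Green" using realizes_colors[OF Cons.prems(1)] by blast
      then show ?thesis
      proof cases
        case 3
        have "realizes V (h @ [({f u, f v}, Green)]) f c d (Board R B (e # G) U)"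
          using realizes_green[OF Cons.prems(1)] e by simp
        then have "winning V l (missing (Board R B (e # G) U) es + n) (h @ [({f u, f v}, Green)])"
          using draw by (rule Cons.IH) (erule Cons.prems(3), auto)
        then show ?thesis using miss 3 by (auto intro: winning_mono)
      qed (use realizes_blocked[OF Cons.prems(1) uv new] blocked in \<open>auto intro: won_imp_winning\<close>)
    qed
    then show ?thesis
      using False realizes_legal[OF Cons.prems(1) uv new] by (auto simp: e)
  qed
qed

fun steps :: "nat list \<Rightarrow> (nat \<times> nat) list" where
  "steps (x # y # zs) = (x, y) # steps (y # zs)"
| "steps _ = []"

lemma successively_map_steps:
  "successively P (map f xs) \<longleftrightarrow> (\<forall>(u, v)\<in>set (steps xs). P (f u) (f v))"
  by (induction xs rule: steps.induct) auto

definition green_path :: "'v set \<Rightarrow> 'v history \<Rightarrow> 'v list \<Rightarrow> bool" where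
  "green_path V h Q \<longleftrightarrow> distinct Q \<and> set Q \<subseteq> V \<and> successively (\<lambda>x y. ({x, y}, Green) \<in> set h) Q"

lemma green_path_mono: "green_path V h Q \<Longrightarrow> set h \<subseteq> set h' \<Longrightarrow> green_path V h' Q"
  unfolding green_path_def by (auto elim: successively_mono)

lemma green_path_rev: "green_path V h (rev Q) \<longleftrightarrow> green_path V h Q"
  by (simp add: green_path_def insert_commute)

text \<open>The vertices 0 and 1 are the ends of the green path \<open>Q\<close>; without a link there is no path yet.\<close>

definition attached :: "(nat \<Rightarrow> 'v) \<Rightarrow> bool \<Rightarrow> 'v list \<Rightarrow> bool" where
  "attached f link Q \<longleftrightarrow>
    (if link then Q \<noteq> [] \<and> hd Q = f 0 \<and> last Q = f 1 \<and> set Q \<inter> range f = {f 0, f 1} else Q = [])"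

lemma attached_mem:
  assumes "inj f" "attached f link Q"
  shows "f x \<in> set Q \<longleftrightarrow> link \<and> (x = 0 \<or> x = 1)"
proof (cases link)
  case True
  then have "f x \<in> set Q \<longleftrightarrow> f x \<in> {f 0, f 1}"
    using assms(2) unfolding attached_def by (metis IntD1 IntI rangeI)
  then show ?thesis using True assms(1) by (simp add: inj_eq)
qed (use assms in \<open>simp add: attached_def\<close>)

text \<open>Two letters for the ends 0 and 1 of the green path: \<open>F\<close> for an end that meets edges of both
  non-green colors, \<open>C\<close> for an arbitrary one. A final \<open>X\<close> stands for a vertex 2 off the path that
  meets a non-green edge, a final \<open>S\<close> or \<open>O\<close> for two such vertices 2 and 3 with the same or with opposite
  colors.\<close>

datatype shape = FFX | FCX | FC | CC | FFS | FFO | START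

fun slots :: "shape \<Rightarrow> nat list" where
  "slots FFX = [0, 1, 2]" | "slots FCX = [0, 1, 2]" | "slots FC = [0, 1]" | "slots CC = [0, 1]"
| "slots FFS = [0, 1, 2, 3]" | "slots FFO = [0, 1, 2, 3]" | "slots START = []"

fun reds :: "shape \<Rightarrow> nat list" where
  "reds FFX = [0, 1, 2]" | "reds FCX = [0, 2]" | "reds FC = [0]" | "reds CC = []"
| "reds FFS = [0, 1, 2, 3]" | "reds FFO = [0, 1, 2]" | "reds START = []"

fun blues :: "shape \<Rightarrow> nat list" where
  "blues FFX = [0, 1]" | "blues FCX = [0]" | "blues FC = [0]" | "blues CC = []"
| "blues FFS = [0, 1]" | "blues FFO = [0, 1, 3]" | "blues START = []"

text \<open>A loose vertex is typically the other end of a non-green edge at a path end, which rules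
  out this pair as a new move. In \<open>CC\<close> the whole path may be the single green edge
  between 0 and 1.\<close>

fun barred :: "shape \<Rightarrow> (nat \<times> nat) list" where
  "barred FFX = [(0, 2)]" | "barred FCX = [(0, 2)]" | "barred FC = []" | "barred CC = [(0, 1)]"
| "barred FFS = [(0, 2), (1, 3)]" | "barred FFO = [(0, 2), (1, 3)]" | "barred START = []"

lemma set_slots: "set (slots T) = {..<length (slots T)}"
  by (cases T) auto

abbreviation board_of :: "shape \<Rightarrow> board" where
  "board_of T \<equiv> Board (reds T) (blues T) [] (barred T)"

text \<open>Here \<open>g\<close> counts the cycle edges still missing: a path on
  \<open>length Q\<close> vertices has one edge fewer. For \<open>START\<close> the empty path makes
  \<open>g = Suc l\<close>, so that each new path vertex lowers \<open>g\<close> by 1 in all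
  cases.\<close>

definition wins :: "'v set \<Rightarrow> nat \<Rightarrow> shape \<Rightarrow> nat \<Rightarrow> nat \<Rightarrow> bool" where
  "wins V l T g n \<longleftrightarrow> (\<forall>h Q f c d. realizes V h f c d (board_of T) \<longrightarrow> attached f (T \<noteq> START) Q \<longrightarrow>
    green_path V h Q \<longrightarrow> length Q + g = Suc l \<longrightarrow> winning V l n h)"

text \<open>A leaf \<open>Close p\<close> closes the cycle through \<open>p\<close>; a leaf \<open>Reduce T p q i\<close> prolongs the green path by \<open>p\<close>
  at 0 and by \<open>q\<close> at 1 and calls the vertices \<open>i\<close> of the new position \<open>0, 1, \<dots>\<close>. The edges missing at a
  leaf are forced ones. The subtrees of \<open>Play u v\<close> answer Painter's two non-green colors and green;
  \<open>Stop\<close> fills answers that lose at once or that are symmetric to another answer.\<close>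

datatype strat =
  Close "nat list"
| Reduce shape "nat list" "nat list" "nat list"
| Play nat nat strat strat strat
| Stop

text \<open>The pair \<open>0, 1\<close> stands for the whole path \<open>Q\<close>, with
  \<open>a\<close> read towards 0 and \<open>b\<close> away from 1. Hence \<open>walk_steps\<close>
  omits the step from 0 to 1.\<close>

fun walk :: "bool \<Rightarrow> nat list \<Rightarrow> nat list \<Rightarrow> nat list" where
  "walk link a b = (if link then a @ [0, 1] @ b else a @ b)"

fun walk_steps :: "bool \<Rightarrow> nat list \<Rightarrow> nat list \<Rightarrow> (nat \<times> nat) list" where
  "walk_steps link a b = (if link then steps (a @ [0]) @ steps (1 # b) else steps (a @ b))"

text \<open>The two non-green colors may be exchanged on the way. The edges \<open>es\<close> drawn
  at the leaf count as used pairs of the new position.\<close>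

definition relabels :: "board \<Rightarrow> (nat \<times> nat) list \<Rightarrow> shape \<Rightarrow> nat list \<Rightarrow> bool" where
  "relabels b es T i = (case b of Board R B G U \<Rightarrow>
    length i = length (slots T) \<and> distinct i \<and>
    ((\<forall>x\<in>set (reds T). i ! x \<in> set R) \<and> (\<forall>x\<in>set (blues T). i ! x \<in> set B) \<or>
     (\<forall>x\<in>set (reds T). i ! x \<in> set B) \<and> (\<forall>x\<in>set (blues T). i ! x \<in> set R)) \<and>
    (\<forall>x\<in>set (slots T). \<forall>y\<in>set (slots T). x \<noteq> y \<longrightarrow>
      joined (barred T) (x, y) \<or> \<not> joined (es @ G @ U) (i ! x, i ! y)))"

text \<open>\<open>P T k m\<close> states what is required of a leaf that adds \<open>k\<close> edges to the path, after \<open>m\<close> rounds.\<close>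

fun valid :: "(shape option \<Rightarrow> nat \<Rightarrow> nat \<Rightarrow> bool) \<Rightarrow> bool \<Rightarrow> board \<Rightarrow> nat \<Rightarrow> strat \<Rightarrow> bool" where
  "valid P link b n (Close p) \<longleftrightarrow> link \<and> distinct (0 # 1 # p) \<and> drawable b (steps (1 # p @ [0])) \<and>
    P None (Suc (length p)) (n + missing b (steps (1 # p @ [0])))"
| "valid P link b n (Reduce T p q i) \<longleftrightarrow> T \<noteq> START \<and> walk link p q \<noteq> [] \<and>
    distinct (walk link p q) \<and> drawable b (walk_steps link p q) \<and>
    relabels b (walk_steps link p q) T i \<and>
    (i ! 0 = hd (walk link p q) \<and> i ! 1 = last (walk link p q) \<or>
     i ! 1 = hd (walk link p q) \<and> i ! 0 = last (walk link p q)) \<and>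
    (\<forall>x\<in>set (drop 2 i). x \<notin> set (walk link p q)) \<and>
    P (Some T) (length p + length q) (n + missing b (walk_steps link p q))"
| "valid P link (Board R B G U) n (Play u v r s t) \<longleftrightarrow> u \<noteq> v \<and> \<not> joined (G @ U) (u, v) \<and>
    (u \<in> set R \<or> v \<in> set R \<or> valid P link (Board (u # v # R) B G ((u, v) # U)) (Suc n) r) \<and>
    (u \<in> set B \<or> v \<in> set B \<or> (\<forall>x\<in>set R. x \<in> set B) \<and> (\<forall>x\<in>set B. x \<in> set R) \<or>
      valid P link (Board R (u # v # B) G ((u, v) # U)) (Suc n) s) \<and>
    valid P link (Board R B ((u, v) # G) U) (Suc n) t"
| "valid P link b n Stop \<longleftrightarrow> False"

text \<open>The green answer is never skipped, so following it always reaches a leaf. This shows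
  that the rounds spent so far stay within the budget.\<close>

lemma valid_imp_demand: "valid P link b n t \<Longrightarrow> \<exists>T k m. P T k m \<and> n \<le> m"
proof (induction t arbitrary: b n)
  case (Close p)
  then show ?case by (auto intro: le_add1)
next
  case (Reduce T p q i)
  then have "P (Some T) (length p + length q) (n + missing b (walk_steps link p q))"
    by (simp only: valid.simps)
  then show ?case using le_add1 by blast
next
  case (Play u v r s t)
  obtain R B G U where "b = Board R B G U" by (cases b)
  with Play.prems have "valid P link (Board R B ((u, v) # G) U) (Suc n) t" by simp
  from Play.IH(3)[OF this] show ?case using Suc_leD by blast
qed simp

section \<open>Soundness of decision trees\<close>

lemma close_wins:
  assumes "realizes V h f c d b" "attached f True Q" "green_path V h Q"
    and "distinct (0 # 1 # p)" "drawable b (steps (1 # p @ [0]))" "length Q + Suc (length p) = Suc l"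
  shows "winning V l (missing b (steps (1 # p @ [0]))) h"
proof -
  obtain R B G U where b: "b = Board R B G U" by (cases b)
  let ?es = "steps (1 # p @ [0])"
  have "winning V l (missing (Board R B G U) ?es + 0) h"
  proof (rule draw_forced)
    show "realizes V h f c d (Board R B G U)" "drawable (Board R B G U) ?es" using assms b by auto
    fix h' G'
    assume *: "realizes V h' f c d (Board R B G' U)" "set G' = set ?es \<union> set G" "set h \<subseteq> set h'"
    let ?P = "\<lambda>x y. ({x, y}, Green) \<in> set h'"
    have inj: "inj f" "range f \<subseteq> V" using * by auto
    have at: "Q \<noteq> []" "hd Q = f 0" "last Q = f 1" "set Q \<inter> range f = {f 0, f 1}"
      using assms(2) by (auto simp: attached_def)
    have "\<forall>(u, v)\<in>set ?es. ?P (f u) (f v)" using * by auto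
    then have "successively ?P (map f (1 # p @ [0]))" by (simp only: successively_map_steps)
    then have "successively ?P ([f 1] @ map f p @ [f 0])" by simp
    then have succ: "successively ?P (map f p)" "p \<noteq> [] \<Longrightarrow> ?P (f 1) (hd (map f p))"
      "p \<noteq> [] \<Longrightarrow> ?P (last (map f p)) (f 0)" "p = [] \<Longrightarrow> ?P (f 1) (f 0)"
      unfolding successively_append_iff by auto
    have path: "green_path V h' Q" using assms(3) *(3) green_path_mono by blast
    have p: "distinct p" "0 \<notin> set p" "1 \<notin> set p" using assms(4) by auto
    have "f i \<notin> set Q" if "i \<in> set p" for i
      using attached_mem[OF inj(1) assms(2), of i] p that by metis
    then have "set Q \<inter> set (map f p) = {}" by auto
    moreover have "distinct (map f p)"
      using p(1) inj_on_subset[OF inj(1) subset_UNIV] by (simp add: distinct_map)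
    ultimately have "distinct (Q @ map f p)" "set (Q @ map f p) \<subseteq> V"
      using path inj(2) by (auto simp: green_path_def)
    moreover have "successively ?P (Q @ map f p)"
      using path succ(1,2) at(1,3) unfolding successively_append_iff green_path_def by auto
    moreover have "?P (last (Q @ map f p)) (hd (Q @ map f p))"
      using succ(3,4) at(1-3) by (cases "p = []") auto
    moreover have "length (Q @ map f p) = l" "l \<noteq> 0" using assms(6) at(1) by auto
    ultimately have "contains_copy (color_graph V h' Green) (cycle_graph l)"
      by (intro contains_cycle[of "Q @ map f p"])
    then show "winning V l 0 h'" by (simp add: builder_won_def)
  qed
  then show ?thesis by (simp add: b)
qed

lemma reduce_wins:
  assumes "realizes V h f c d b" "attached f link Q" "green_path V h Q"
    and "T \<noteq> START" "walk link p q \<noteq> []" "distinct (walk link p q)" "drawable b (walk_steps link p q)"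
    and "relabels b (walk_steps link p q) T i"
    and ends: "i ! 0 = hd (walk link p q) \<and> i ! 1 = last (walk link p q) \<or>
      i ! 1 = hd (walk link p q) \<and> i ! 0 = last (walk link p q)"
    and alive: "\<forall>x\<in>set (drop 2 i). x \<notin> set (walk link p q)"
    and "wins V l T g n" "length Q + (length p + length q) + g = Suc l"
  shows "winning V l (missing b (walk_steps link p q) + n) h"
proof -
  obtain R B G U where b: "b = Board R B G U" by (cases b)
  define es where "es = walk_steps link p q"
  define w where "w = walk link p q"
  have "winning V l (missing (Board R B G U) es + n) h"
  proof (rule draw_forced)
    show "realizes V h f c d (Board R B G U)" "drawable (Board R B G U) es"
      using assms b by (auto simp: es_def)
    fix h' G'
    assume *: "realizes V h' f c d (Board R B G' U)" "set G' = set es \<union> set G" "set h \<subseteq> set h'"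
    let ?P = "\<lambda>x y. ({x, y}, Green) \<in> set h'"
    have inj: "inj f" "range f \<subseteq> V" using * by auto
    have path: "green_path V h' Q" using assms(3) *(3) green_path_mono by blast
    have es: "\<forall>(u, v)\<in>set es. ?P (f u) (f v)" using * by auto
    define Q' where "Q' = map f p @ Q @ map f q"
    have mem: "f x \<in> set Q' \<longleftrightarrow> x \<in> set w" for x
      using attached_mem[OF inj(1) assms(2)] inj(1) by (auto simp: Q'_def w_def inj_image_mem_iff)
    have hd: "hd Q' = f (hd w)"
      using assms(2,5) by (cases link; cases p) (auto simp: Q'_def w_def attached_def hd_map)
    have last: "last Q' = f (last w)"
      using assms(2,5) by (cases link; cases q rule: rev_cases) (auto simp: Q'_def w_def attached_def last_map)
    have ne: "Q' \<noteq> []"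
      using assms(2,5) by (cases link) (auto simp: Q'_def attached_def)
    have "distinct Q'"
    proof -
      have "distinct p" "distinct q" "set p \<inter> set q = {}"
        and away: "link \<longrightarrow> 0 \<notin> set p \<union> set q \<and> 1 \<notin> set p \<union> set q"
        using assms(6) by (cases link; auto)+
      moreover have "f x \<notin> set Q" if "x \<in> set p \<union> set q" for x
        using attached_mem[OF inj(1) assms(2), of x] away that by metis
      moreover have "distinct Q" using path by (simp add: green_path_def)
      ultimately show ?thesis
        using inj_on_subset[OF inj(1) subset_UNIV] inj(1)
        by (auto simp: Q'_def distinct_map inj_eq)
    qed
    moreover have "set Q' \<subseteq> V" using path inj(2) by (auto simp: Q'_def green_path_def)
    moreover have "successively ?P Q'"
    proof (cases link)
      case True
      then have "successively ?P (map f (p @ [0]))" "successively ?P (map f (1 # q))"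
        unfolding successively_map_steps using es by (auto simp: es_def)
      then show ?thesis using path assms(2) True
        by (auto simp: Q'_def green_path_def attached_def successively_append_iff successively_Cons)
    next
      case False
      then have "successively ?P (map f (p @ q))"
        unfolding successively_map_steps using es by (auto simp: es_def)
      then show ?thesis using assms(2) False by (simp add: Q'_def attached_def)
    qed
    ultimately have path': "green_path V h' Q'" by (simp add: green_path_def)
    \<comment> \<open>Names from \<open>N\<close> on occur in no recorded pair, so all pairs that
      involve them are undrawn.\<close>
    define N where "N = Suc (Max (set i \<union> set w \<union> fst ` set (G' @ U) \<union> snd ` set (G' @ U)))"
    have N: "x < N" if "x \<in> set i \<union> set w \<union> fst ` set (G' @ U) \<union> snd ` set (G' @ U)" for x
      using that unfolding N_def by (intro le_imp_less_Suc Max_ge) auto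
    have bound: "x < N \<and> y < N" if "joined (G' @ U) (x, y)" for x y
    proof -
      have "x < N \<and> y < N" if "(x, y) \<in> set (G' @ U)" for x y
        using image_eqI[of x fst, OF _ that] image_eqI[of y snd, OF _ that] N[of x] N[of y] by simp
      then show ?thesis using that by (auto simp: joined_def)
    qed
    define \<iota> where "\<iota> x = (if x < length i then i ! x else N + x)" for x
    have "joined (G' @ U) e = joined (es @ G @ U) e" for e
      using *(2) by (auto simp: joined_def)
    then have rel: "length i = length (slots T)" "distinct i"
      "(\<forall>x\<in>set (reds T). i ! x \<in> set R) \<and> (\<forall>x\<in>set (blues T). i ! x \<in> set B) \<or>
       (\<forall>x\<in>set (reds T). i ! x \<in> set B) \<and> (\<forall>x\<in>set (blues T). i ! x \<in> set R)"
      "\<And>x y. x < length (slots T) \<Longrightarrow> y < length (slots T) \<Longrightarrow> x \<noteq> y \<Longrightarrow> \<not> joined (barred T) (x, y) \<Longrightarrow>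
        \<not> joined (G' @ U) (i ! x, i ! y)"
      using assms(8) unfolding relabels_def b board.case es_def[symmetric] set_slots
      by (blast intro: lessThan_iff[THEN iffD2])+
    have low: "x < length i" if "x \<in> set (reds T) \<union> set (blues T)" for x
      using that rel(1) by (cases T) auto
    have small: "i ! x < N" if "x < length i" for x using that by (intro N) simp
    have "inj \<iota>"
    proof (rule injI)
      fix x y assume "\<iota> x = \<iota> y"
      then show "x = y" using small[of x] small[of y] rel(2)
        by (auto simp: \<iota>_def nth_eq_iff_index_eq split: if_splits)
    qed
    have und: "{f (\<iota> x), f (\<iota> y)} \<notin> fst ` set h'" if "x \<noteq> y" "\<not> joined (barred T) (x, y)" for x y
    proof -
      have "\<not> joined (G' @ U) (\<iota> x, \<iota> y)"
      proof (cases "x < length i \<and> y < length i")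
        case True
        then show ?thesis using rel(1,4) that by (simp add: \<iota>_def)
      next
        case False
        then have "\<not> \<iota> x < N \<or> \<not> \<iota> y < N" by (auto simp: \<iota>_def)
        then show ?thesis using bound by blast
      qed
      moreover have "\<iota> x \<noteq> \<iota> y" using that \<open>inj \<iota>\<close> by (simp add: inj_eq)
      ultimately show ?thesis using *(1) by simp
    qed
    have inj': "inj (f \<circ> \<iota>)" "range (f \<circ> \<iota>) \<subseteq> V"
      using inj \<open>inj \<iota>\<close> by (auto intro: inj_compose)
    obtain c' d' where real: "realizes V h' (f \<circ> \<iota>) c' d' (board_of T)"
    proof -
      have cd: "{c, d} = {Red, Blue}" "{d, c} = {Red, Blue}" using *(1) by (auto simp: insert_commute)
      from rel(3) consider
          "\<forall>x\<in>set (reds T). i ! x \<in> set R" "\<forall>x\<in>set (blues T). i ! x \<in> set B"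
        | "\<forall>x\<in>set (reds T). i ! x \<in> set B" "\<forall>x\<in>set (blues T). i ! x \<in> set R" by blast
      then show thesis
      proof cases
        case 1
        then have "realizes V h' (f \<circ> \<iota>) c d (board_of T)"
          using *(1) inj' und cd low by (auto simp: \<iota>_def)
        then show ?thesis by (rule that)
      next
        case 2
        then have "realizes V h' (f \<circ> \<iota>) d c (board_of T)"
          using *(1) inj' und cd low by (auto simp: \<iota>_def)
        then show ?thesis by (rule that)
      qed
    qed
    have two: "2 \<le> length i" using rel(1) assms(4) by (cases T) auto
    have sets: "set Q' \<inter> range (f \<circ> \<iota>) = {f (\<iota> 0), f (\<iota> 1)}"
    proof -
      have "\<iota> x \<in> set w \<longleftrightarrow> x = 0 \<or> x = 1" for x
      proof (cases "x < length i")
        case True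
        show ?thesis
        proof
          assume "\<iota> x \<in> set w"
          then have "i ! x \<notin> set (drop 2 i)" using alive True by (auto simp: \<iota>_def w_def)
          then have "x \<noteq> y + 2" for y using True nth_mem[of y "drop 2 i"] by auto
          then have "\<not> 2 \<le> x" by (metis le_add_diff_inverse2)
          then show "x = 0 \<or> x = 1" by auto
        next
          assume "x = 0 \<or> x = 1"
          moreover have "i ! 0 \<in> set w" "i ! 1 \<in> set w"
            using ends[folded w_def] assms(5)[folded w_def] hd_in_set[of w] last_in_set[of w] by metis+
          ultimately show "\<iota> x \<in> set w" using two by (auto simp: \<iota>_def)
        qed
      next
        case False
        then have "\<not> \<iota> x < N" by (simp add: \<iota>_def)
        then show ?thesis using N[of "\<iota> x"] False two by auto
      qed
      then have "{x. \<iota> x \<in> set w} = {0, 1}" by blast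
      moreover have "set Q' \<inter> range (f \<circ> \<iota>) = (\<lambda>x. f (\<iota> x)) ` {x. \<iota> x \<in> set w}"
        by (auto simp: mem)
      ultimately show ?thesis by simp
    qed
    have \<iota>: "\<iota> 0 = i ! 0" "\<iota> 1 = i ! 1" using two by (auto simp: \<iota>_def)
    \<comment> \<open>\<open>i\<close> may list the ends in either order; in one of them the path is
      read backwards.\<close>
    from ends[folded w_def] have "attached (f \<circ> \<iota>) True Q' \<or> attached (f \<circ> \<iota>) True (rev Q')"
    proof
      assume "i ! 0 = hd w \<and> i ! 1 = last w"
      then have "hd Q' = (f \<circ> \<iota>) 0" "last Q' = (f \<circ> \<iota>) 1"
        by (simp_all only: comp_apply hd last \<iota>)
      then show ?thesis using ne sets unfolding attached_def if_True comp_apply by blast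
    next
      assume "i ! 1 = hd w \<and> i ! 0 = last w"
      then have "hd (rev Q') = (f \<circ> \<iota>) 0" "last (rev Q') = (f \<circ> \<iota>) 1"
        by (simp_all only: comp_apply hd last \<iota> hd_rev last_rev)
      then show ?thesis
        using ne sets unfolding attached_def if_True comp_apply set_rev rev_is_Nil_conv by blast
    qed
    moreover have "length Q' + g = Suc l" using assms(12) by (simp add: Q'_def)
    ultimately show "winning V l n h'"
      using assms(4,11) real path' green_path_rev[of V h' Q'] unfolding wins_def
      by (metis length_rev)
  qed
  then show ?thesis by (simp add: b es_def)
qed

text \<open>\<open>None\<close> stands for a closed cycle, which must have exactly the right length.
  The inequalities keep both subtractions from truncating.\<close>

definition meets :: "'v set \<Rightarrow> nat \<Rightarrow> nat \<Rightarrow> nat \<Rightarrow> shape option \<Rightarrow> nat \<Rightarrow> nat \<Rightarrow> bool" where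
  "meets V l g n T k m \<longleftrightarrow> m \<le> n \<and>
    (case T of None \<Rightarrow> g = k | Some T' \<Rightarrow> k \<le> g \<and> wins V l T' (g - k) (n - m))"

lemma valid_winning:
  assumes "valid (meets V l g n) link b m t"
    and "realizes V h f c d b" "attached f link Q" "green_path V h Q" "length Q + g = Suc l"
  shows "winning V l (n - m) h"
  using assms
proof (induction t arbitrary: b m h c d)
  case (Close p)
  then have "winning V l (missing b (steps (1 # p @ [0]))) h"
    by (intro close_wins[of V h f c d b Q]) (auto simp: meets_def)
  then show ?case using Close.prems(1) by (auto simp: meets_def elim!: winning_mono)
next
  case (Reduce T p q i)
  let ?m = "m + missing b (walk_steps link p q)"
  have "winning V l (missing b (walk_steps link p q) + (n - ?m)) h"
    using Reduce.prems
    by (intro reduce_wins[of V h f c d b link Q T p q i l "g - (length p + length q)"]) (auto simp: meets_def)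
  then show ?case using Reduce.prems(1) by (auto simp: meets_def)
next
  case (Play u v r s t)
  obtain R B G U where b: "b = Board R B G U" by (cases b)
  have uv: "u \<noteq> v" "\<not> joined (G @ U) (u, v)" using Play.prems(1) b by auto
  have real: "realizes V h f c d (Board R B G U)" using Play.prems(2) b by simp
  have val: "u \<in> set R \<or> v \<in> set R \<or> valid (meets V l g n) link (Board (u # v # R) B G ((u, v) # U)) (Suc m) r"
    "u \<in> set B \<or> v \<in> set B \<or> set R = set B \<or>
      valid (meets V l g n) link (Board R (u # v # B) G ((u, v) # U)) (Suc m) s"
    "valid (meets V l g n) link (Board R B ((u, v) # G) U) (Suc m) t"
    using Play.prems(1) b by (auto simp: set_eq_iff)
  \<comment> \<open>The green subtree has a leaf, reached after at least \<open>Suc m\<close>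
    rounds.\<close>
  have "m < n" using valid_imp_demand[OF val(3)] by (auto simp: meets_def)
  have path: "green_path V (h @ [x]) Q" for x
    using Play.prems(4) by (rule green_path_mono) auto
  have "winning V l (n - Suc m) (h @ [({f u, f v}, x)])" for x
  proof -
    consider "x = c" | "x = d" | "x = Green" using realizes_colors[OF real] by blast
    then show ?thesis
    proof cases
      case 1
      show ?thesis
      proof (cases "u \<in> set R \<or> v \<in> set R")
        case True
        then show ?thesis using realizes_blocked(1)[OF real uv] 1 by (auto intro: won_imp_winning)
      next
        case False
        then show ?thesis
          using Play.IH(1)[OF _ realizes_nongreen(1)[OF real uv(1)] Play.prems(3) path Play.prems(5)] val(1) 1
          by auto
      qed
    next
      case 2
      show ?thesis
      proof (cases "u \<in> set B \<or> v \<in> set B")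
        case True
        then show ?thesis using realizes_blocked(2)[OF real uv] 2 by (auto intro: won_imp_winning)
      next
        case F: False
        show ?thesis
        \<comment> \<open>With equal lists the position is symmetric in the two colors, so the
          subtree \<open>r\<close> answers \<open>d\<close> as well.\<close>
        proof (cases "set R = set B")
          case True
          then have "realizes V h f d c (Board R B G U)" using realizes_swap[OF real] by auto
          from Play.IH(1)[OF _ realizes_nongreen(1)[OF this uv(1)] Play.prems(3) path Play.prems(5)]
          show ?thesis using val(1) 2 F True by auto
        next
          case False
          then show ?thesis
            using Play.IH(2)[OF _ realizes_nongreen(2)[OF real uv(1)] Play.prems(3) path Play.prems(5)] val(2) 2 F
            by auto
        qed
      qed
    next
      case 3
      then show ?thesis
        using Play.IH(3)[OF val(3) realizes_green[OF real] Play.prems(3) path Play.prems(5)] by simp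
    qed
  qed
  then have "winning V l (Suc (n - Suc m)) h"
    using realizes_legal[OF real uv] by auto
  then show ?case using \<open>m < n\<close> by (simp add: Suc_diff_Suc)
next
  case Stop
  then show ?case by simp
qed

lemma valid_wins: "valid (meets V l g n) (T \<noteq> START) (board_of T) 0 t \<Longrightarrow> wins V l T g n"
  unfolding wins_def using valid_winning[of V l g n "T \<noteq> START" "board_of T" 0 t] by simp

lemma wins_mono: "wins V l T g n \<Longrightarrow> n \<le> m \<Longrightarrow> wins V l T g m"
  unfolding wins_def by (meson winning_mono)

section \<open>Decision trees\<close>

text \<open>In these lemmas \<open>P\<close> stays arbitrary and the assumptions list what the
  leaves require. One check of a tree thus serves every number of missing edges. A numeric suffix is
  the number of missing edges for which the tree is meant.\<close>

lemma FFX_1: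
  assumes "P None 1 1"
  shows "valid P True (board_of FFX) 0
   (Close [])"
  using assms by (simp add: joined_def relabels_def; simp add: eval_nat_numeral)

lemma FFX_2:
  assumes "P None 2 2"
  shows "valid P True (board_of FFX) 0
   (Close [3])"
  using assms by (simp add: joined_def relabels_def; simp add: eval_nat_numeral)

lemma FFX_3:
  assumes "P None 3 3" "P None 3 4"
  shows "valid P True (board_of FFX) 0
   (Play 2 3 Stop
      (Close [2,4])
      (Close [2,3]))"
  using assms by (simp add: joined_def relabels_def; simp add: eval_nat_numeral)

text \<open>\<open>FFX_step\<close> could end in \<open>FC\<close> with 3 edges missing, which
  exceptionally needs 6 rounds: 9 in all, against the allowed 8.\<close>

lemma FFX_6:
  assumes "P None 6 7" "P None 6 8" "P (Some FCX) 2 2"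
  shows "valid P True (board_of FFX) 0
   (Play 3 4
      (Play 2 3 Stop
        (Close [5,2,6,3,7])
        (Play 2 4 Stop
          (Close [3,2,5,4,6])
          (Play 3 5 Stop
            (Close [6,3,2,4,5])
            (Play 4 6 Stop
              (Close [7,4,2,3,5])
              (Close [5,3,2,4,6])))))
      (Play 3 5
        (Close [6,3,2,4,5]) Stop
        (Play 4 6
          (Close [2,3,5,4,7]) Stop
          (Close [5,3,2,4,6])))
      (Reduce FCX [] [3,4] [0,4,2]))"
  using assms by (simp add: joined_def relabels_def; simp add: eval_nat_numeral)

text \<open>Vertex 2 meets one color already. The other color makes it meet both, and it becomes a
  new end with forced edges. Two green answers put it inside the path, with no round wasted but a
  weaker end.\<close>

lemma FFX_step:
  assumes "P (Some FC) 3 3" "P (Some FFX) 2 3"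
  shows "valid P True (board_of FFX) 0
   (Play 2 3 Stop
      (Reduce FFX [2,4] [] [2,1,3])
      (Play 2 4 Stop
        (Reduce FFX [2,3] [] [2,1,4])
        (Reduce FC [] [3,2,4] [0,4])))"
  using assms by (simp add: joined_def relabels_def; simp add: eval_nat_numeral)

lemma FCX_1:
  assumes "P None 1 1"
  shows "valid P True (board_of FCX) 0
   (Close [])"
  using assms by (simp add: joined_def relabels_def; simp add: eval_nat_numeral)

lemma FCX_2:
  assumes "P None 2 2" "P None 2 3" "P None 2 4"
  shows "valid P True (board_of FCX) 0
   (Play 1 3
      (Play 1 4 Stop
        (Close [5])
        (Close [4]))
      (Play 1 4
        (Close [5]) Stop
        (Close [4]))
      (Close [3]))"
  using assms by (simp add: joined_def relabels_def; simp add: eval_nat_numeral)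

lemma FCX_3:
  assumes "P None 3 4" "P None 3 5"
  shows "valid P True (board_of FCX) 0
   (Play 3 4
      (Play 1 3 Stop
        (Close [2,3])
        (Play 3 5 Stop
          (Close [3,6])
          (Close [3,5])))
      (Play 1 5
        (Close [3,5])
        (Close [2,3])
        (Play 3 5
          (Close [5,4]) Stop
          (Close [5,3])))
      (Play 1 2 Stop
        (Play 1 3
          (Close [4,3]) Stop
          (Close [3,4]))
        (Play 2 3 Stop
          (Close [2,5])
          (Close [2,3]))))"
  using assms by (simp add: joined_def relabels_def; simp add: eval_nat_numeral)

lemma FCX_4:
  assumes "P None 4 5" "P None 4 6" "P (Some FC) 2 2"
  shows "valid P True (board_of FCX) 0
   (Play 1 2 Stop
      (Play 1 3
        (Close [4,2,5]) Stop
        (Close [3,2,4]))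
      (Play 2 3 Stop
        (Play 3 4
          (Close [2,5,3]) Stop
          (Close [2,4,3]))
        (Reduce FC [] [2,3] [0,3])))"
  using assms by (simp add: joined_def relabels_def; simp add: eval_nat_numeral)

lemma FCX_5:
  assumes "P None 5 7" "P None 5 8" "P (Some FC) 3 4" "P (Some FCX) 1 1" "P (Some FCX) 1 2"
    "P (Some FFX) 2 4"
  shows "valid P True (board_of FCX) 0
   (Play 1 3
      (Play 1 4 Stop
        (Play 2 5 Stop
          (Close [2,4,3,5])
          (Close [5,2,4,3]))
        (Reduce FCX [] [4] [0,4,2]))
      (Play 3 4
        (Reduce FFX [] [2,3] [3,0,4]) Stop
        (Reduce FC [] [2,3,4] [0,4]))
      (Reduce FCX [] [3] [0,3,2]))"
  using assms by (simp add: joined_def relabels_def; simp add: eval_nat_numeral)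

lemma FCX_6:
  assumes "P None 6 8" "P None 6 9" "P (Some FCX) 1 1" "P (Some FCX) 2 3" "P (Some FFX) 3 5"
  shows "valid P True (board_of FCX) 0
   (Play 1 3
      (Play 1 4 Stop
        (Play 2 5 Stop
          (Close [6,2,4,3,5])
          (Play 3 6 Stop
            (Close [7,3,4,2,5])
            (Close [5,2,4,3,6])))
        (Play 3 4 Stop
          (Play 2 5 Stop
            (Close [4,2,6,3,7])
            (Close [4,2,5,3,6]))
          (Reduce FCX [] [4,3] [0,3,2])))
      (Play 1 4
        (Play 2 5 Stop
          (Close [6,2,3,4,5])
          (Play 4 6 Stop
            (Close [7,4,3,2,5])
            (Close [5,2,3,4,6]))) Stop
        (Play 3 4
          (Play 4 5 Stop
            (Close [4,2,5,3,6])
            (Reduce FFX [] [4,5,3] [0,3,2])) Stop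
          (Reduce FCX [] [4,3] [0,3,2])))
      (Reduce FCX [] [3] [0,3,2]))"
  using assms by (simp add: joined_def relabels_def; simp add: eval_nat_numeral)

text \<open>Again \<open>FCX_step\<close> could end in the expensive \<open>FC\<close> with 3 edges
  missing, for 7 + 6 rounds against the allowed 12.\<close>

lemma FCX_8:
  assumes "P (Some CC) 3 3" "P (Some FCX) 2 3"
  shows "valid P True (board_of FCX) 0
   (Play 2 3 Stop
      (Reduce FCX [2,4] [] [2,1,3])
      (Play 2 4 Stop
        (Reduce FCX [] [2,3] [0,3,4])
        (Reduce CC [4,2,3] [] [4,1])))"
  using assms by (simp add: joined_def relabels_def; simp add: eval_nat_numeral)

lemma FCX_step:
  assumes "P (Some FC) 2 2" "P (Some FC) 3 4" "P (Some FC) 5 7" "P (Some FFX) 3 5"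
    "P (Some FFX) 4 7"
  shows "valid P True (board_of FCX) 0
   (Play 1 2 Stop
      (Play 1 3
        (Play 3 4 Stop
          (Reduce FFX [] [5,2,6,3] [3,0,4])
          (Play 3 5 Stop
            (Reduce FFX [] [6,2,4,3] [3,0,5])
            (Reduce FC [] [6,2,4,3,5] [0,5]))) Stop
        (Reduce FC [2,4] [3] [2,3]))
      (Play 2 3 Stop
        (Play 3 4
          (Reduce FFX [] [2,5,3] [3,0,4]) Stop
          (Reduce FC [] [2,4,3] [0,3]))
        (Reduce FC [] [2,3] [0,3])))"
  using assms by (simp add: joined_def relabels_def; simp add: eval_nat_numeral)

lemma FC_1:
  assumes "P None 1 1"
  shows "valid P True (board_of FC) 0
   (Close [])"
  using assms by (simp add: joined_def relabels_def; simp add: eval_nat_numeral)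

lemma FC_2:
  assumes "P None 2 2" "P None 2 3" "P None 2 4"
  shows "valid P True (board_of FC) 0
   (Play 1 2
      (Play 1 3 Stop
        (Close [4])
        (Close [3])) Stop
      (Close [2]))"
  using assms by (simp add: joined_def relabels_def; simp add: eval_nat_numeral)

lemma FC_3:
  assumes "P None 3 5" "P None 3 6" "P (Some FC) 1 1" "P (Some FCX) 1 2"
  shows "valid P True (board_of FC) 0
   (Play 1 2
      (Play 1 3 Stop
        (Play 2 4 Stop
          (Close [5,2])
          (Close [4,2]))
        (Reduce FCX [] [3] [0,3,2])) Stop
      (Reduce FC [] [2] [0,2]))"
  using assms by (simp add: joined_def relabels_def; simp add: eval_nat_numeral)

lemma FC_4:
  assumes "P None 4 6" "P None 4 7" "P (Some FC) 1 1" "P (Some FCX) 1 2"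
  shows "valid P True (board_of FC) 0
   (Play 1 2
      (Play 1 3 Stop
        (Play 2 4 Stop
          (Close [5,2,6])
          (Close [4,2,3]))
        (Reduce FCX [] [3] [0,3,2])) Stop
      (Reduce FC [] [2] [0,2]))"
  using assms by (simp add: joined_def relabels_def; simp add: eval_nat_numeral)

lemma FC_5:
  assumes "P None 5 7" "P None 5 8" "P (Some FC) 1 1" "P (Some FC) 3 4"
  shows "valid P True (board_of FC) 0
   (Play 1 2
      (Play 2 3 Stop
        (Play 3 4
          (Close [3,5,2,6]) Stop
          (Close [3,4,2,5]))
        (Play 1 4 Stop
          (Play 4 5
            (Close [3,2,4,6]) Stop
            (Close [3,2,4,5]))
          (Play 2 4 Stop
            (Play 3 4
              (Close [4,5,2,3]) Stop
              (Close [4,3,2,5]))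
            (Reduce FC [] [4,2,3] [0,3])))) Stop
      (Reduce FC [] [2] [0,2]))"
  using assms by (simp add: joined_def relabels_def; simp add: eval_nat_numeral)

text \<open>\<open>FC_step\<close> could leave \<open>FC\<close> with 3 edges missing after 6
  rounds, one round over the allowed 11.\<close>

lemma FC_7:
  assumes "P (Some CC) 2 2" "P None 7 11" "P (Some FCX) 2 3" "P (Some FFX) 1 3"
    "P (Some FFX) 2 4" "P (Some FFX) 3 6"
  shows "valid P True (board_of FC) 0
   (Play 2 3
      (Play 1 2 Stop
        (Play 1 4
          (Play 3 5 Stop
            (Close [6,2,7,3,4,5])
            (Reduce FFX [] [3,5,2] [0,2,4])) Stop
          (Reduce FFX [] [4,2] [2,0,3]))
        (Play 2 4 Stop
          (Reduce FFX [] [2] [2,0,3])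
          (Reduce FCX [] [2,4] [0,4,3]))) Stop
      (Reduce CC [3,2] [] [3,1]))"
  using assms by (simp add: joined_def relabels_def; simp add: eval_nat_numeral)

lemma FC_step:
  assumes "P (Some FC) 2 3" "P (Some FC) 4 6" "P (Some FCX) 2 3" "P (Some FCX) 3 4"
    "P (Some FCX) 3 5" "P (Some FFX) 1 3" "P (Some FFX) 3 6"
  shows "valid P True (board_of FC) 0
   (Play 2 3
      (Play 1 2 Stop
        (Play 3 4 Stop
          (Reduce FFX [] [3,5,2] [0,2,4])
          (Reduce FC [2,5] [3,4] [2,4]))
        (Play 2 4 Stop
          (Reduce FFX [] [2] [2,0,3])
          (Reduce FCX [] [2,4] [0,4,3]))) Stop
      (Play 1 4
        (Play 1 2 Stop
          (Play 4 5 Stop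
            (Reduce FFX [] [3,2,4] [4,0,5])
            (Reduce FC [] [3,2,4,5] [0,5]))
          (Reduce FCX [] [2,3] [0,3,4])) Stop
        (Play 4 5
          (Play 2 4 Stop
            (Reduce FCX [] [4,3,2] [0,2,5])
            (Reduce FCX [] [4,2,3] [0,3,5])) Stop
          (Reduce FC [] [4,5] [0,5]))))"
  using assms by (simp add: joined_def relabels_def; simp add: eval_nat_numeral)

lemma CC_4:
  assumes "P None 4 4" "P None 4 5" "P None 4 6" "P None 4 7" "P None 4 8" "P (Some FCX) 1 3"
    "P (Some FCX) 2 4"
  shows "valid P True (board_of CC) 0
   (Play 2 3
      (Play 0 2 Stop
        (Play 3 4 Stop
          (Close [2,5,3])
          (Close [2,4,3]))
        (Play 2 4 Stop
          (Reduce FCX [2] [] [2,1,3])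
          (Play 1 3 Stop
            (Close [2,4,3])
            (Play 3 4 Stop
              (Play 2 5 Stop
                (Close [3,6,2])
                (Close [3,5,2]))
              (Close [3,4,2]))))) Stop
      (Play 0 4
        (Play 0 2 Stop
          (Play 1 2
            (Play 1 3 Stop
              (Close [5,2,3])
              (Close [3,2,5])) Stop
            (Reduce FCX [] [2,3] [0,3,4]))
          (Play 1 4 Stop
            (Play 1 3
              (Close [5,4,2]) Stop
              (Close [3,4,2]))
            (Play 3 4 Stop
              (Close [4,2,3])
              (Close [4,3,2])))) Stop
        (Play 1 2
          (Play 2 4 Stop
            (Play 4 5
              (Close [4,3,2]) Stop
              (Close [4,5,2]))
            (Play 1 3 Stop
              (Play 2 5 Stop
                (Close [6,2,4])
                (Close [5,2,4]))
              (Close [3,2,4]))) Stop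
          (Play 3 4
            (Play 2 4 Stop
              (Play 2 5
                (Close [2,6,4]) Stop
                (Close [2,5,4]))
              (Play 1 3 Stop
                (Close [4,2,3])
                (Close [3,2,4]))) Stop
            (Close [2,3,4])))))"
  using assms by (simp add: joined_def relabels_def; simp add: eval_nat_numeral)

lemma CC_5:
  assumes "P (Some CC) 1 1" "P None 5 6" "P None 5 7" "P None 5 8" "P None 5 9"
    "P (Some FC) 3 5"
  shows "valid P True (board_of CC) 0
   (Play 0 2
      (Play 2 3 Stop
        (Play 3 4
          (Play 0 4 Stop
            (Close [2,5,3,6])
            (Close [3,5,2,4])) Stop
          (Reduce FC [4,3] [2] [2,4]))
        (Play 2 4 Stop
          (Play 3 4
            (Play 0 3 Stop
              (Close [2,3,5,4])
              (Close [4,5,2,3])) Stop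
            (Reduce FC [2,3,4] [] [2,1]))
          (Play 3 5
            (Play 1 5 Stop
              (Close [3,2,4,5])
              (Play 4 5 Stop
                (Close [5,2,3,4])
                (Play 0 3 Stop
                  (Close [3,2,4,5])
                  (Close [5,4,2,3]))))
            (Play 1 3
              (Close [5,2,4,3]) Stop
              (Play 3 4
                (Close [3,2,4,5]) Stop
                (Close [3,4,2,5])))
            (Play 1 4
              (Play 1 5 Stop
                (Close [3,2,4,5])
                (Play 0 4 Stop
                  (Close [5,4,2,3])
                  (Close [5,3,2,4])))
              (Play 1 5
                (Close [2,3,5,4]) Stop
                (Close [5,3,2,4]))
              (Play 0 5 Stop
                (Close [4,2,5,3])
                (Close [4,2,3,5])))))) Stop
      (Reduce CC [2] [] [2,1]))"
  using assms by (simp add: joined_def relabels_def; simp add: eval_nat_numeral)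

lemma CC_6:
  assumes "P (Some CC) 1 1" "P (Some CC) 1 2" "P (Some FCX) 1 3" "P (Some FCX) 2 5"
  shows "valid P True (board_of CC) 0
   (Play 0 2
      (Play 0 3 Stop
        (Play 1 4
          (Reduce FCX [] [3,4] [0,4,2])
          (Reduce FCX [] [2,4] [0,4,3])
          (Reduce FCX [] [4] [0,4,2]))
        (Reduce CC [3] [] [3,1])) Stop
      (Reduce CC [2] [] [2,1]))"
  using assms by (simp add: joined_def relabels_def; simp add: eval_nat_numeral)

text \<open>\<open>CC_step\<close> may leave \<open>CC\<close> with 4 edges fewer, hence with only
  3, where no bound for \<open>CC\<close> is provided. This tree avoids that leaf.\<close>

lemma CC_7:
  assumes "P (Some CC) 1 1" "P (Some CC) 2 3" "P (Some FC) 3 5" "P (Some FCX) 1 3"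
    "P (Some FCX) 3 6" "P (Some FFX) 3 7"
  shows "valid P True (board_of CC) 0
   (Play 0 2
      (Play 0 3 Stop
        (Play 1 4
          (Play 4 5 Stop
            (Reduce FFX [] [3,2,4] [4,0,5])
            (Reduce FCX [] [3,4,5] [0,5,2]))
          (Play 4 5
            (Reduce FFX [] [2,3,4] [4,0,5]) Stop
            (Reduce FCX [] [2,4,5] [0,5,3]))
          (Reduce FCX [] [4] [0,4,2]))
        (Play 1 2 Stop
          (Play 1 4
            (Reduce FCX [3] [5,2] [2,3,4]) Stop
            (Reduce FC [3] [4,2] [2,3]))
          (Reduce CC [3] [2] [3,2]))) Stop
      (Reduce CC [2] [] [2,1]))"
  using assms by (simp add: joined_def relabels_def; simp add: eval_nat_numeral)

lemma CC_step:
  assumes "P (Some CC) 1 1" "P (Some CC) 2 3" "P (Some CC) 4 6" "P (Some FC) 3 5"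
    "P (Some FCX) 3 6" "P (Some FFX) 3 7"
  shows "valid P True (board_of CC) 0
   (Play 0 2
      (Play 0 3 Stop
        (Play 2 4 Stop
          (Play 1 3
            (Reduce FFX [3,5] [2] [2,3,4]) Stop
            (Reduce FCX [2,5] [3] [2,3,4]))
          (Play 3 5
            (Reduce FCX [] [3,2,4] [0,4,5]) Stop
            (Reduce CC [5,3,2,4] [] [5,1])))
        (Play 1 2 Stop
          (Play 1 4
            (Reduce FCX [3] [5,2] [2,3,4]) Stop
            (Reduce FC [3] [4,2] [2,3]))
          (Reduce CC [3] [2] [3,2]))) Stop
      (Reduce CC [2] [] [2,1]))"
  using assms by (simp add: joined_def relabels_def; simp add: eval_nat_numeral)

lemma CC_opening:
  assumes "P (Some CC) 3 3" "P (Some CC) 4 5" "P (Some CC) 5 7" "P (Some FC) 3 5"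
    "P (Some FCX) 4 7" "P (Some FFX) 4 8"
  shows "valid P True (board_of CC) 0
   (Play 2 3
      (Play 2 4 Stop
        (Play 3 5 Stop
          (Play 0 4
            (Reduce FFX [3,6,2] [4] [3,4,5]) Stop
            (Reduce FCX [4] [2,6,3] [3,4,5]))
          (Play 4 6
            (Reduce FCX [] [2,5,3,4] [4,0,6]) Stop
            (Reduce CC [] [2,5,3,4,6] [0,6])))
        (Play 0 3 Stop
          (Reduce FC [4,2] [3] [3,4])
          (Play 2 5 Stop
            (Play 5 6
              (Reduce FCX [3] [2,4,5] [5,3,6]) Stop
              (Reduce CC [6,5,3] [2,4] [6,4]))
            (Play 3 4 Stop
              (Play 4 6
                (Reduce FCX [3] [4,2,5] [3,5,6]) Stop
                (Reduce CC [6,4,2,5,3] [] [6,1]))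
              (Reduce CC [5,2,4,3] [] [5,1]))))) Stop
      (Play 0 4
        (Play 2 4 Stop
          (Reduce FC [3,2] [4] [4,3])
          (Play 0 5 Stop
            (Play 5 6
              (Reduce FCX [] [5,4,2,3] [0,3,6]) Stop
              (Reduce CC [6,5,4,2,3] [] [6,1]))
            (Play 1 4 Stop
              (Play 1 6
                (Reduce FCX [5] [3,2,4] [4,5,6]) Stop
                (Reduce CC [5] [6,4,2,3] [5,3]))
              (Reduce CC [5] [4,2,3] [5,3])))) Stop
        (Play 1 2
          (Play 1 5 Stop
            (Play 5 6
              (Reduce FCX [4] [3,2,5] [5,4,6]) Stop
              (Reduce CC [4] [3,2,5,6] [4,6]))
            (Play 2 4 Stop
              (Play 4 6
                (Reduce FCX [4] [5,2,3] [4,3,6]) Stop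
                (Reduce CC [6,4] [5,2,3] [6,3]))
              (Reduce CC [3,2,4] [5] [3,5]))) Stop
          (Reduce CC [4] [2,3] [4,3]))))"
  using assms by (simp add: joined_def relabels_def; simp add: eval_nat_numeral)

lemma FFS_5:
  assumes "P None 5 5" "P None 5 6"
  shows "valid P True (board_of FFS) 0
   (Play 2 3 Stop
      (Close [2,4,3,5])
      (Play 2 4 Stop
        (Close [5,2,3,4])
        (Play 3 5 Stop
          (Close [6,3,2,4])
          (Close [4,2,3,5]))))"
  using assms by (simp add: joined_def relabels_def; simp add: eval_nat_numeral)

text \<open>When vertex 2 gets its second color, the new loose vertex has that color, whereas 2 had
  the first. So equal loose colors become opposite while two edges are gained;
  \<open>FFO_step\<close> is the reverse switch.\<close>

lemma FFS_step:
  assumes "P (Some FCX) 3 3" "P (Some FFO) 2 3"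
  shows "valid P True (board_of FFS) 0
   (Play 2 4 Stop
      (Reduce FFO [2,5] [] [2,1,4,3])
      (Play 2 5 Stop
        (Reduce FFO [2,4] [] [2,1,5,3])
        (Reduce FCX [] [4,2,5] [0,5,3])))"
  using assms by (simp add: joined_def relabels_def; simp add: eval_nat_numeral)

text \<open>Opposite colors at 2 and 3 force even the edge between them, so every closing edge is
  forced.\<close>

lemma FFO_3:
  assumes "P None 3 3"
  shows "valid P True (board_of FFO) 0
   (Close [2,3])"
  using assms by (simp add: joined_def relabels_def; simp add: eval_nat_numeral)

lemma FFO_step:
  assumes "P (Some FCX) 3 3" "P (Some FFS) 2 3"
  shows "valid P True (board_of FFO) 0
   (Play 2 4 Stop
      (Reduce FFS [2,5] [] [2,1,4,3])
      (Play 2 5 Stop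
        (Reduce FFS [2,4] [] [2,1,5,3])
        (Reduce FCX [] [4,2,5] [0,5,3])))"
  using assms by (simp add: joined_def relabels_def; simp add: eval_nat_numeral)

lemma START_opening:
  assumes "P (Some CC) 2 1" "P (Some CC) 4 4" "P (Some CC) 6 7" "P (Some FC) 5 6"
    "P (Some FC) 7 9" "P (Some FCX) 6 8" "P (Some FFO) 5 8" "P (Some FFX) 6 9"
  shows "valid P False (board_of START) 0
   (Play 0 1
      (Play 0 2 Stop
        (Play 1 3 Stop
          (Play 2 4
            (Reduce FFO [] [1,5,0,6,2] [1,2,3,4]) Stop
            (Play 2 5
              (Reduce FFO [] [1,6,0,4,2] [1,2,3,5]) Stop
              (Reduce FCX [] [0,6,1,4,2,5] [0,5,3])))
          (Play 2 4
            (Play 1 5 Stop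
              (Reduce FFO [] [1,3,0,6,2] [1,2,5,4])
              (Reduce FCX [] [0,6,2,3,1,5] [0,5,4])) Stop
            (Reduce FC [] [0,3,1,2,4] [0,4])))
        (Play 0 3 Stop
          (Play 1 4 Stop
            (Play 3 5
              (Reduce FFO [] [1,6,0,2,3] [1,3,4,5]) Stop
              (Play 3 6
                (Reduce FFO [] [1,2,0,5,3] [1,3,4,6]) Stop
                (Reduce FCX [] [0,2,1,5,3,6] [0,6,4])))
            (Play 3 5
              (Play 1 6 Stop
                (Reduce FFO [] [1,4,0,2,3] [1,3,6,5])
                (Reduce FCX [] [0,2,3,4,1,6] [0,6,5])) Stop
              (Reduce CC [] [2,0,4,1,3,5] [2,5])))
          (Play 1 2 Stop
            (Play 2 4
              (Play 4 5 Stop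
                (Reduce FFX [] [1,6,2,0,3,4] [4,1,5])
                (Play 4 6 Stop
                  (Reduce FFX [] [1,3,0,2,5,4] [4,1,6])
                  (Reduce FC [] [1,3,0,2,5,4,6] [1,6]))) Stop
              (Reduce FC [] [1,3,0,2,4] [1,4]))
            (Reduce CC [] [1,2,0,3] [1,3])))) Stop
      (Reduce CC [] [0,1] [0,1]))"
  using assms by (simp add: joined_def relabels_def; simp add: eval_nat_numeral)

section \<open>Counting rounds\<close>

lemma valid_mono:
  assumes "\<And>T k m. P T k m \<Longrightarrow> P' T k m"
  shows "valid P link b n t \<Longrightarrow> valid P' link b n t"
proof (induction t arbitrary: b n)
  case (Play u v r s t)
  obtain R B G U where b: "b = Board R B G U" by (cases b)
  show ?case using Play unfolding b valid.simps by blast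
next
  case (Reduce T p q i)
  then show ?case using assms unfolding valid.simps by blast
next
  case (Close p)
  then show ?case using assms unfolding valid.simps by blast
qed simp

text \<open>Up to the exceptions for small \<open>g\<close>, the number of rounds needed for the \<open>g\<close> missing edges is
  \<open>(3 * g + \<kappa>) / 2\<close> rounded up, with \<open>\<kappa>\<close> equal to -2, 0, 1, 3, -3, -3 for the shapes in the order of their
  declaration. The congruences make the colors of the vertices 2 and 3 match when the cycle is
  closed.\<close>

fun available :: "shape \<Rightarrow> nat \<Rightarrow> bool" where
  "available CC g \<longleftrightarrow> 4 \<le> g"
| "available FFS g \<longleftrightarrow> 5 \<le> g \<and> g mod 4 = 1"
| "available FFO g \<longleftrightarrow> g mod 4 = 3"
| "available START g \<longleftrightarrow> False"
| "available T g \<longleftrightarrow> 1 \<le> g"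

fun needed :: "shape \<Rightarrow> nat \<Rightarrow> nat" where
  "needed FFX g = (3 * g - 1) div 2"
| "needed FCX g = (if g = 2 then 4 else (3 * g + 1) div 2)"
| "needed FC g = (if g = 3 then 6 else (3 * g + 2) div 2)"
| "needed CC g = (3 * g + 4) div 2"
| "needed T g = (3 * g - 3) div 2"

text \<open>The instance of \<open>P\<close> used in the recursion: each leaf must leave fewer, but
  still some, missing edges and must stay within the budget for them.\<close>

fun demand :: "nat \<Rightarrow> nat \<Rightarrow> shape option \<Rightarrow> nat \<Rightarrow> nat \<Rightarrow> bool" where
  "demand g n None k m \<longleftrightarrow> g = k \<and> m \<le> n"
| "demand g n (Some T) k m \<longleftrightarrow> 0 < k \<and> k < g \<and> available T (g - k) \<and> m + needed T (g - k) \<le> n"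

lemma demand_wins:
  assumes "\<And>T k. 0 < k \<Longrightarrow> k < g \<Longrightarrow> available T (g - k) \<Longrightarrow> wins V l T (g - k) (needed T (g - k))"
    and "valid (demand g n) (T \<noteq> START) (board_of T) 0 t"
  shows "wins V l T g n"
proof -
  have "meets V l g n T' k m" if "demand g n T' k m" for T' k m
    using that assms(1) by (cases T') (auto simp: meets_def intro!: wins_mono[OF assms(1)])
  then show ?thesis using valid_mono[of "demand g n" "meets V l g n"] assms(2) by (blast intro: valid_wins)
qed

lemma plan_exists:
  assumes "available T g"
  shows "\<exists>t. valid (demand g (needed T g)) True (board_of T) 0 t"
proof (cases T)
  case FFX
  consider "g = 1" | "g = 2" | "g = 3" | "g = 6" | "4 \<le> g" "g \<noteq> 6" using assms FFX by force
  then show ?thesis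
  proof cases
    case 1 show ?thesis unfolding FFX 1 by (rule exI, rule FFX_1) auto
  next
    case 2 show ?thesis unfolding FFX 2 by (rule exI, rule FFX_2) auto
  next
    case 3 show ?thesis unfolding FFX 3 by (rule exI, rule FFX_3) auto
  next
    case 4 show ?thesis unfolding FFX 4 by (rule exI, rule FFX_6) auto
  next
    case 5 show ?thesis unfolding FFX
      by (rule exI, rule FFX_step; use 5 in \<open>simp split: if_split; presburger\<close>)
  qed
next
  case FCX
  consider "g = 1" | "g = 2" | "g = 3" | "g = 4" | "g = 5" | "g = 6" | "g = 8" | "7 \<le> g" "g \<noteq> 8"
    using assms FCX by force
  then show ?thesis
  proof cases
    case 1 show ?thesis unfolding FCX 1 by (rule exI, rule FCX_1) auto
  next
    case 2 show ?thesis unfolding FCX 2 by (rule exI, rule FCX_2) auto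
  next
    case 3 show ?thesis unfolding FCX 3 by (rule exI, rule FCX_3) auto
  next
    case 4 show ?thesis unfolding FCX 4 by (rule exI, rule FCX_4) auto
  next
    case 5 show ?thesis unfolding FCX 5 by (rule exI, rule FCX_5) auto
  next
    case 6 show ?thesis unfolding FCX 6 by (rule exI, rule FCX_6) auto
  next
    case 7 show ?thesis unfolding FCX 7 by (rule exI, rule FCX_8) auto
  next
    case 8 show ?thesis unfolding FCX
      by (rule exI, rule FCX_step; use 8 in \<open>simp split: if_split; presburger\<close>)
  qed
next
  case FC
  have "\<exists>j. g \<in> {1, 2, 3, 4, 5, 6, 7} \<or> g = 2 * j + 8 \<or> g = 2 * j + 9"
    using assms FC by simp presburger
  then consider "g = 1" | "g = 2" | "g = 3" | "g = 4" | "g = 5" | "g = 7" | "g = 6"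
    | j where "g = 2 * j + 8" | j where "g = 2 * j + 9"
    by auto
  then show ?thesis
  proof cases
    case 1 show ?thesis unfolding FC 1 by (rule exI, rule FC_1) auto
  next
    case 2 show ?thesis unfolding FC 2 by (rule exI, rule FC_2) auto
  next
    case 3 show ?thesis unfolding FC 3 by (rule exI, rule FC_3) auto
  next
    case 4 show ?thesis unfolding FC 4 by (rule exI, rule FC_4) auto
  next
    case 5 show ?thesis unfolding FC 5 by (rule exI, rule FC_5) auto
  next
    case 6 show ?thesis unfolding FC 6 by (rule exI, rule FC_7) auto
  next
    case 7 show ?thesis unfolding FC 7 by (rule exI, rule FC_step) auto
  next
    case 8 show ?thesis unfolding FC 8 by (rule exI, rule FC_step; simp)
  next
    case 9 show ?thesis unfolding FC 9 by (rule exI, rule FC_step; simp)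
  qed
next
  case CC
  consider "g = 4" | "g = 5" | "g = 6" | "g = 7" | "8 \<le> g" using assms CC by force
  then show ?thesis
  proof cases
    case 1 show ?thesis unfolding CC 1 by (rule exI, rule CC_4) auto
  next
    case 2 show ?thesis unfolding CC 2 by (rule exI, rule CC_5) auto
  next
    case 3 show ?thesis unfolding CC 3 by (rule exI, rule CC_6) auto
  next
    case 4 show ?thesis unfolding CC 4 by (rule exI, rule CC_7) auto
  next
    case 5 show ?thesis unfolding CC
      by (rule exI, rule CC_step; use 5 in \<open>simp split: if_split; presburger\<close>)
  qed
next
  case FFS
  then have "\<exists>k. g = 5 \<or> g = 4 * k + 9" using assms by simp presburger
  then consider "g = 5" | k where "g = 4 * k + 9" by blast
  then show ?thesis
  proof cases
    case 1 show ?thesis unfolding FFS 1 by (rule exI, rule FFS_5) auto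
  next
    case 2 show ?thesis unfolding FFS
      by (rule exI, rule FFS_step; use 2 in \<open>simp split: if_split; presburger\<close>)
  qed
next
  case FFO
  then have "\<exists>k. g = 3 \<or> g = 4 * k + 7" using assms by simp presburger
  then consider "g = 3" | k where "g = 4 * k + 7" by blast
  then show ?thesis
  proof cases
    case 1 show ?thesis unfolding FFO 1 by (rule exI, rule FFO_3) auto
  next
    case 2 show ?thesis unfolding FFO
      by (rule exI, rule FFO_step; use 2 in \<open>simp split: if_split; presburger\<close>)
  qed
next
  case START
  with assms show ?thesis by simp
qed

text \<open>The trees lead from one shape to another, so the induction on \<open>g\<close> treats
  all shapes at once.\<close>

lemma available_wins: "available T g \<Longrightarrow> wins V l T g (needed T g)"
proof (induction g arbitrary: T rule: less_induct)
  case (less g)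
  obtain t where t: "valid (demand g (needed T g)) True (board_of T) 0 t"
    using plan_exists[OF less.prems] by blast
  have "T \<noteq> START" using less.prems by auto
  then have "valid (demand g (needed T g)) (T \<noteq> START) (board_of T) 0 t" using t by (simp only: simp_thms)
  then show ?case
  proof (rule demand_wins[rotated])
    show "wins V l T (g - k) (needed T (g - k))" if "0 < k" "k < g" "available T (g - k)" for T k
      using that by (intro less.IH) auto
  qed
qed

text \<open>Saves a round over \<open>needed CC\<close> if \<open>g\<close> is even. A leaf of
  \<open>CC_opening\<close> may gain 5 edges and still be \<open>CC\<close>, which requires 4
  missing edges; hence the 9.\<close>

lemma wins_CC_opening:
  assumes "9 \<le> g"
  shows "wins V l CC g ((3 * g + 3) div 2)"
proof -
  have "\<exists>j. g = 2 * j + 9 \<or> g = 2 * j + 10" using assms by presburger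
  then obtain j where "g = 2 * j + 9 \<or> g = 2 * j + 10" by blast
  then have "\<exists>t. valid (demand g ((3 * g + 3) div 2)) True (board_of CC) 0 t"
  proof
    assume g: "g = 2 * j + 9"
    show ?thesis unfolding g by (rule exI, rule CC_opening; simp)
  next
    assume g: "g = 2 * j + 10"
    show ?thesis unfolding g by (rule exI, rule CC_opening; simp)
  qed
  then obtain t where "valid (demand g ((3 * g + 3) div 2)) (CC \<noteq> START) (board_of CC) 0 t" by auto
  then show ?thesis
    by (rule demand_wins[rotated]) (rule available_wins)
qed

text \<open>Vertex 3 is forgotten, which removes the congruence condition on
  \<open>g\<close>.\<close>

lemma wins_FFO_if_FFX:
  assumes "wins V l FFX g n"
  shows "wins V l FFO g n"
proof (rule valid_wins)
  show "valid (meets V l g n) (FFO \<noteq> START) (board_of FFO) 0 (Reduce FFX [] [] [0, 1, 2])"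
    using assms by (simp add: joined_def relabels_def meets_def)
qed

text \<open>The critical leaves are \<open>CC\<close> and \<open>FFO\<close>. For
  \<open>l mod 4 = 3\<close> the bound \<open>needed CC\<close> would be one round too large, hence
  \<open>wins_CC_opening\<close>, and \<open>FFO\<close> must use its own bound. For other residues
  the bound of \<open>FFX\<close> suffices for \<open>FFO\<close>.\<close>

lemma wins_START:
  assumes "16 \<le> l" "3 * l + 1 \<le> 2 * n" "l mod 4 \<noteq> 3 \<Longrightarrow> 3 * l + 2 \<le> 2 * n"
  shows "wins V l START (Suc l) n"
proof -
  \<comment> \<open>Clears the halving in the round bounds; the \<open>+ 1\<close> absorbs rounding
    down.\<close>
  have half: "m + x div 2 \<le> n" if "2 * m + x \<le> 2 * n + 1" for m x :: nat
    using that by presburger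
  have meets: "meets V l (Suc l) n (Some T) k m"
    if "wins V l T (Suc l - k) r" "m + r \<le> n" "k \<le> Suc l" for T k m r
    using that by (auto simp: meets_def intro: wins_mono)
  have CC: "meets V l (Suc l) n (Some CC) k m"
    if "9 \<le> Suc l - k" "2 * m + (3 * (Suc l - k) + 3) \<le> 2 * n + 1" for k m
    using that by (intro meets[OF wins_CC_opening] half) auto
  have other: "meets V l (Suc l) n (Some T) k m"
    if "available T (Suc l - k)" "m + needed T (Suc l - k) \<le> n" "k \<le> Suc l" for T k m
    using that by (intro meets[OF available_wins])
  have FFO: "meets V l (Suc l) n (Some FFO) 5 8"
  proof (cases "l mod 4 = 3")
    case True
    moreover have "l - 4 + 4 = l" using assms(1) by simp
    ultimately have "(l - 4) mod 4 = 3" using mod_add_self2[of "l - 4" 4] by simp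
    then show ?thesis using assms(1,2) by (intro other) (auto intro!: half)
  next
    case False
    have "wins V l FFO (Suc l - 5) (needed FFX (Suc l - 5))"
      using assms(1) by (intro wins_FFO_if_FFX available_wins) simp
    then show ?thesis using assms(1) assms(3)[OF False] by (intro meets) (auto intro!: half)
  qed
  have "\<exists>t. valid (meets V l (Suc l) n) (START \<noteq> START) (board_of START) 0 t"
    unfolding simp_thms
    by (rule exI, rule START_opening; (rule FFO | rule CC | rule other))
      (use assms(1,2) in \<open>auto intro!: half\<close>)
  then show ?thesis using valid_wins by blast
qed

lemma wins_within_upper_bound:
  assumes "infinite V" "16 \<le> l"
  shows "builder_wins_within V (path_graph 3) (path_graph 3) (cycle_graph l)
    (if l mod 4 = 3 then (3 * l + 1) div 2 else (3 * (l + 1)) div 2)"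
proof (rule winning_imp_wins_within[OF assms(1)])
  let ?n = "if l mod 4 = 3 then (3 * l + 1) div 2 else (3 * (l + 1)) div 2"
  obtain f :: "nat \<Rightarrow> 'a" where f: "inj f" "range f \<subseteq> V"
    using infinite_countable_subset[OF assms(1)] by blast
  have "3 * l + 1 \<le> 2 * ?n" "l mod 4 \<noteq> 3 \<Longrightarrow> 3 * l + 2 \<le> 2 * ?n" by presburger+
  then have "wins V l START (Suc l) ?n" using assms(2) by (intro wins_START)
  moreover have "realizes V [] f Red Blue (board_of START)" using f by simp
  moreover have "attached f (START \<noteq> START) []" "green_path V [] []"
    by (simp_all add: attached_def green_path_def)
  moreover have "length ([] :: 'a list) + Suc l = Suc l" by simp
  ultimately show "winning V l ?n []" unfolding wins_def by blast
qed

theorem theorem1p2: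
  fixes V :: "'v set" and l :: nat
  assumes "infinite V" and "l \<ge> 16"
  shows "online_ramsey V (path_graph 3) (path_graph 3) (cycle_graph l) =
    enat (if l mod 4 = 3 then (3 * l + 1) div 2 else (3 * (l + 1)) div 2)"
  unfolding online_ramsey_def
proof (rule antisym)
  show "(INF n\<in>{n. builder_wins_within V (path_graph 3) (path_graph 3) (cycle_graph l) n}. enat n)
      \<le> enat (if l mod 4 = 3 then (3 * l + 1) div 2 else (3 * (l + 1)) div 2)"
    using wins_within_upper_bound[OF assms] by (intro INF_lower) simp
  show "enat (if l mod 4 = 3 then (3 * l + 1) div 2 else (3 * (l + 1)) div 2)
      \<le> (INF n\<in>{n. builder_wins_within V (path_graph 3) (path_graph 3) (cycle_graph l) n}. enat n)"
  proof (rule INF_greatest)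
    fix n assume "n \<in> {n. builder_wins_within V (path_graph 3) (path_graph 3) (cycle_graph l) n}"
    then show "enat (if l mod 4 = 3 then (3 * l + 1) div 2 else (3 * (l + 1)) div 2) \<le> enat n"
      using wins_within_lower_bound[of V l n] assms(2) by simp
  qed
qed

end
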